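(* Let $G(k)$ be an algebraic $N\times N$ matrix function with $\det G\not\equiv 0$, with branch points off the real axis, and with balanced Riemann surface. If $G$ admits a commutative factorization $$Q^+(k)\,Q^-(k)=Q^-(k)\,Q^+(k)=G(k),$$ where $Q^+,Q^-$ are factors of the type described in the context, then $G$ is branch-commutative.
   Context: Setting. $G(k)$ is an $N\times N$ matrix whose entries are algebraic functions of $k\in\mathbb C$. A branch of $G$ is fixed in a narrow strip $-\epsilon<\mathrm{Im}\,k<\epsilon$ along the real axis. The branch points of $G$ lie off the real axis (outside the strip); their affixes (projections to the $k$-plane) are $\tau_m^+$ with $\mathrm{Im}\,\tau_m^+>0$ and $\tau_m^-$ with $\mathrm{Im}\,\tau_m^-<0$. Factors. In a factorization of $G$, $Q^+(k)$ is analytic (except possibly for some isolated poles), continuous and of algebraic growth in the upper half-plane $\mathrm{Im}\,k>-\epsilon$, $Q^-(k)$ has the same properties in the lower half-plane $\mathrm{Im}\,k<\epsilon$, and the factorization identities hold in the strip, where $G$ is the fixed branch. Algebraic growth means that there is a number $l$ such that all matrix elements grow no faster than $|k|^l$ in the corresponding half-plane. Bypasses. Draw pairwise disjoint cuts $\gamma_m^+$ from $\tau_m^+$ to infinity in the upper half-plane and $\gamma_m^-$ from $\tau_m^-$ to infinity in the lower half-plane, none meeting the real axis. The branch of $G$ on the cut plane extending the fixed branch on the strip is called the physical sheet. The letter $a_i$ denotes a bypass about $\tau_i^+$ in the positive direction: a closed path based at a point $k$ of the strip, lying in $\mathrm{Im}\,k>-\epsilon$, crossing $\gamma_i^+$ once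 and no other cut. The letter $b_i$ similarly denotes a bypass about $\tau_i^-$ in the positive direction, lying in $\mathrm{Im}\,k<\epsilon$ and crossing only $\gamma_i^-$. A word in these letters denotes the consecutive bypasses, read from left to right (leftmost performed first); $e$ is the trivial word. $\mathcal W$ is the set of all words, and $\mathcal W_a$, $\mathcal W_b$ are the sets of words composed only of letters $a_i$, respectively only of letters $b_i$ (both containing $e$). $G(k)\{w\}$ is the value at $k$ obtained by analytic continuation of $G$ along $w$ starting from the physical value $G(k)\{e\}$. Balanced. The Riemann surface of $G$ is called balanced if for any $w\in\mathcal W$ there exist words $w_a\in\mathcal W_a$ and $w_b\in\mathcal W_b$ such that $G(k)\{w_a\}=G(k)\{w_b\}=G(k)\{w\}$ (identically in $k$). Branch-commutative. $G$ is called branch-commutative if for any $k$ the values of $G$ on different sheets of its Riemann surface commute, i.e. $G(k)\{w_1\}\,G(k)\{w_2\}-G(k)\{w_2\}\,G(k)\{w_1\}=0$ for any words $w_1,w_2\in\mathcal W$. *)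

theory Defs
  imports "HOL-Complex_Analysis.Complex_Analysis" "HOL-Library.Landau_Symbols"
begin

unbundle no fps_syntax

definition strip :: "real \<Rightarrow> complex set" where
  "strip \<epsilon> = {k. - \<epsilon> < Im k \<and> Im k < \<epsilon>}"

definition upper_half :: "real \<Rightarrow> complex set" where
  "upper_half \<epsilon> = {k. - \<epsilon> < Im k}"

definition lower_half :: "real \<Rightarrow> complex set" where
  "lower_half \<epsilon> = {k. Im k < \<epsilon>}"

type_synonym 'n matrix_fun = "complex \<Rightarrow> complex^'n^'n"

definition matrix_pole :: "('n::finite) matrix_fun \<Rightarrow> complex \<Rightarrow> bool" where
  "matrix_pole G k \<longleftrightarrow> (\<exists>i j. is_pole (\<lambda>z. G z $ i $ j) k)"

text \<open>
  Nicely meromorphic functions are continuous except at their (isolated) poles,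
  where by the library convention they take the value 0.
  A polynomial in \<open>w\<close> with coefficients in \<open>\<complex>[z]\<close> is evaluated at \<open>(z, w)\<close> by first
  substituting the constant polynomial \<open>w\<close>.
\<close>

definition algebraic_matrix_on :: "complex set \<Rightarrow> ('n::finite) matrix_fun \<Rightarrow> bool" where
  "algebraic_matrix_on S G \<longleftrightarrow>
     (\<forall>i j. (\<lambda>z. G z $ i $ j) nicely_meromorphic_on S \<and>
        (\<exists>P :: complex poly poly. P \<noteq> 0 \<and>
           (\<forall>z\<in>S. \<not> is_pole (\<lambda>u. G u $ i $ j) z \<longrightarrow> poly (poly P [:G z $ i $ j:]) z = 0)))"

definition factor_on :: "complex set \<Rightarrow> ('n::finite) matrix_fun \<Rightarrow> bool" where
  "factor_on H Q \<longleftrightarrow>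
     (\<forall>i j. (\<lambda>z. Q z $ i $ j) nicely_meromorphic_on H) \<and>
     (\<exists>l::real. \<forall>i j. (\<lambda>k. norm (Q k $ i $ j))
        \<in> O[inf at_infinity (principal H)](\<lambda>k. norm k powr l))"

text \<open>
  Analytic continuation is continuation of germs of meromorphic matrix functions, so that a
  path on the Riemann surface may pass through poles (but not through branch points).
  Two functions have the same germ at \<open>k\<close> if they agree on a punctured neighbourhood of \<open>k\<close>.
\<close>

definition same_germ :: "complex \<Rightarrow> ('n::finite) matrix_fun \<Rightarrow> 'n matrix_fun \<Rightarrow> bool" where
  "same_germ k f g \<longleftrightarrow> eventually (\<lambda>z. f z = g z) (at k)"

definition continues_along ::
    "(real \<Rightarrow> complex) \<Rightarrow> ('n::finite) matrix_fun \<Rightarrow> 'n matrix_fun \<Rightarrow> bool" where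
  "continues_along p f g \<longleftrightarrow> path p \<and>
     (\<exists>F :: real \<Rightarrow> 'n matrix_fun.
        (\<forall>t\<in>{0..1}. \<forall>i j. (\<lambda>z. F t z $ i $ j) meromorphic_on {p t}) \<and>
        (\<forall>t\<in>{0..1}. eventually (\<lambda>s. same_germ (p s) (F s) (F t)) (at t within {0..1})) \<and>
        same_germ (pathstart p) (F 0) f \<and>
        same_germ (pathfinish p) (F 1) g)"

text \<open>
  The affixes of the branch points, on all sheets: arbitrarily close to \<open>\<tau>\<close>, some germ obtained
  by continuing the given branch out of \<open>S\<close> changes under continuation along a closed path in
  the punctured disc about \<open>\<tau>\<close>.
\<close>

definition branch_points :: "complex set \<Rightarrow> ('n::finite) matrix_fun \<Rightarrow> complex set" where
  "branch_points S G = {\<tau>. \<forall>r>0. \<exists>p q g h.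
     pathstart p \<in> S \<and> continues_along p G g \<and>
     pathstart q = pathfinish p \<and> pathfinish q = pathfinish p \<and>
     path_image q \<subseteq> ball \<tau> r - {\<tau>} \<and> continues_along q g h \<and>
     \<not> same_germ (pathfinish p) g h}"

text \<open>
  The cut from \<open>\<tau>\<close> to infinity is the simple curve \<open>\<gamma> \<tau>\<close>, parametrized by \<open>[0, \<infinity>)\<close>. The cuts
  stay off the strip, since the physical sheet on the cut plane extends the branch fixed there.
\<close>

definition cut_system :: "real \<Rightarrow> complex set \<Rightarrow> (complex \<Rightarrow> real \<Rightarrow> complex) \<Rightarrow> bool" where
  "cut_system \<epsilon> T \<gamma> \<longleftrightarrow>
     (\<forall>\<tau>\<in>T. continuous_on {0..} (\<gamma> \<tau>) \<and> inj_on (\<gamma> \<tau>) {0..} \<and> \<gamma> \<tau> 0 = \<tau> \<and>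
        filterlim (\<gamma> \<tau>) at_infinity at_top \<and>
        (0 < Im \<tau> \<longrightarrow> (\<forall>t\<ge>0. \<epsilon> \<le> Im (\<gamma> \<tau> t))) \<and>
        (Im \<tau> < 0 \<longrightarrow> (\<forall>t\<ge>0. Im (\<gamma> \<tau> t) \<le> - \<epsilon>))) \<and>
     (\<forall>\<sigma>\<in>T. \<forall>\<tau>\<in>T. \<sigma> \<noteq> \<tau> \<longrightarrow> \<gamma> \<sigma> ` {0..} \<inter> \<gamma> \<tau> ` {0..} = {})"

text \<open>
  Letters are the affixes themselves: \<open>\<tau>\<close> is a letter \<open>a\<close> if \<open>0 < Im \<tau>\<close> and a letter \<open>b\<close>
  if \<open>Im \<tau> < 0\<close>. Winding number 1 expresses the positive direction; together with the single
  common point with the cut, it also forces a genuine crossing there.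
\<close>

definition bypass ::
    "real \<Rightarrow> complex set \<Rightarrow> (complex \<Rightarrow> real \<Rightarrow> complex) \<Rightarrow> complex \<Rightarrow> complex
      \<Rightarrow> (real \<Rightarrow> complex) \<Rightarrow> bool" where
  "bypass \<epsilon> T \<gamma> \<tau> k p \<longleftrightarrow>
     path p \<and> pathstart p = k \<and> pathfinish p = k \<and>
     path_image p \<subseteq> (if 0 < Im \<tau> then upper_half \<epsilon> else lower_half \<epsilon>) \<and>
     \<tau> \<notin> path_image p \<and> winding_number p \<tau> = 1 \<and>
     (\<exists>!t. t \<in> {0..1} \<and> p t \<in> \<gamma> \<tau> ` {0..}) \<and>
     (\<forall>\<sigma>\<in>T - {\<tau>}. path_image p \<inter> \<gamma> \<sigma> ` {0..} = {})"

definition all_words :: "complex set \<Rightarrow> complex list set" where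
  "all_words T = lists T"

definition a_words :: "complex set \<Rightarrow> complex list set" where
  "a_words T = lists {\<tau>\<in>T. 0 < Im \<tau>}"

definition b_words :: "complex set \<Rightarrow> complex list set" where
  "b_words T = lists {\<tau>\<in>T. Im \<tau> < 0}"

fun continues_word ::
    "real \<Rightarrow> complex set \<Rightarrow> (complex \<Rightarrow> real \<Rightarrow> complex) \<Rightarrow> complex list \<Rightarrow> complex
      \<Rightarrow> ('n::finite) matrix_fun \<Rightarrow> 'n matrix_fun \<Rightarrow> bool" where
  "continues_word \<epsilon> T \<gamma> [] k f g \<longleftrightarrow> same_germ k f g"
| "continues_word \<epsilon> T \<gamma> (\<tau> # w) k f g \<longleftrightarrow>
     (\<exists>p h. bypass \<epsilon> T \<gamma> \<tau> k p \<and> continues_along p f h \<and> continues_word \<epsilon> T \<gamma> w k h g)"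

text \<open>
  \<open>word_values \<epsilon> \<gamma> G w k\<close> is the value of \<open>G\<close> at \<open>k\<close> on the sheet reached along the word \<open>w\<close>, as
  the set of values obtained from all bypasses representing the letters. By the monodromy
  theorem it is a singleton, or empty if \<open>k\<close> is a pole on that sheet.
\<close>

definition word_values ::
    "real \<Rightarrow> (complex \<Rightarrow> real \<Rightarrow> complex) \<Rightarrow> ('n::finite) matrix_fun \<Rightarrow> complex list \<Rightarrow> complex
      \<Rightarrow> (complex^'n^'n) set" where
  "word_values \<epsilon> \<gamma> G w k =
     {v. \<exists>g. continues_word \<epsilon> (branch_points (strip \<epsilon>) G) \<gamma> w k G g \<and> (g \<longlongrightarrow> v) (at k)}"

definition balanced ::
    "real \<Rightarrow> (complex \<Rightarrow> real \<Rightarrow> complex) \<Rightarrow> ('n::finite) matrix_fun \<Rightarrow> bool" where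
  "balanced \<epsilon> \<gamma> G \<longleftrightarrow> (let T = branch_points (strip \<epsilon>) G in
     \<forall>w\<in>all_words T. \<exists>wa\<in>a_words T. \<exists>wb\<in>b_words T. \<forall>k\<in>strip \<epsilon>.
       word_values \<epsilon> \<gamma> G wa k = word_values \<epsilon> \<gamma> G w k \<and>
       word_values \<epsilon> \<gamma> G wb k = word_values \<epsilon> \<gamma> G w k)"

definition branch_commutative ::
    "real \<Rightarrow> (complex \<Rightarrow> real \<Rightarrow> complex) \<Rightarrow> (complex \<Rightarrow> complex^'n^'n::finite) \<Rightarrow> bool" where
  "branch_commutative \<epsilon> \<gamma> G \<longleftrightarrow> (let T = branch_points (strip \<epsilon>) G in
     \<forall>k\<in>strip \<epsilon>. \<forall>w1\<in>all_words T. \<forall>w2\<in>all_words T.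
       \<forall>A\<in>word_values \<epsilon> \<gamma> G w1 k. \<forall>B\<in>word_values \<epsilon> \<gamma> G w2 k. A ** B - B ** A = 0)"

text \<open>The factorization identities are required wherever neither factor has a pole.\<close>

definition commutative_factorization ::
    "real \<Rightarrow> (complex \<Rightarrow> complex^'n^'n::finite) \<Rightarrow> 'n matrix_fun \<Rightarrow> 'n matrix_fun \<Rightarrow> bool" where
  "commutative_factorization \<epsilon> G Qp Qm \<longleftrightarrow>
     factor_on (upper_half \<epsilon>) Qp \<and> factor_on (lower_half \<epsilon>) Qm \<and>
     (\<forall>k\<in>strip \<epsilon>. \<not> matrix_pole Qp k \<and> \<not> matrix_pole Qm k \<longrightarrow>
        Qp k ** Qm k = G k \<and> Qm k ** Qp k = G k)"

end

theory Submission
  imports Defs "HOL-Computational_Algebra.Fundamental_Theorem_Algebra"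
begin

unbundle no fps_syntax

text \<open>
  Continuation along an a-word stays in the half-plane where \<open>Q\<^sup>+\<close> is single-valued, and \<open>Q\<^sup>+\<close>
  commutes with \<open>G = Q\<^sup>+ Q\<^sup>- = Q\<^sup>- Q\<^sup>+\<close>, so every value \<open>G{w\<^sub>a}\<close> commutes with \<open>Q\<^sup>+\<close>; likewise every
  \<open>G{w\<^sub>b}\<close> commutes with \<open>Q\<^sup>-\<close>. By balancedness every \<open>G{w}\<close> commutes with both factors, hence with
  the physical branch \<open>G\<close>. Continuing this relation along \<open>w\<^sub>2\<close> shows that \<open>G{w w\<^sub>2}\<close> commutes with
  \<open>G{w\<^sub>2}\<close>, and every branch has the form \<open>G{w w\<^sub>2}\<close>: an algebraic function has finitely many
  germs, so the injective continuation along \<open>w\<^sub>2\<close> permutes the branches.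

  The last step needs that every branch can be continued along every path avoiding the branch points.
  Off the finitely many critical points of a minimal polynomial the graph of an entry is a covering
  space, which lifts paths; near a critical point that is not a branch point the trivial
  monodromy gives a single-valued function on the punctured disc, which is meromorphic at the
  centre because a root times the leading coefficient is bounded.
\<close>

section \<open>Families of germs along a path\<close>

text \<open>Two features of the definitions shape the work. Continuation deals with germs on
  punctured neighbourhoods, because a path may run through poles. Every comparison of branches
  therefore goes through one identity principle: along a path, a family of meromorphic germs
  vanishes everywhere or nowhere. Equality, commutation and an algebraic equation are each
  transported by applying it to a difference or to an expression in the germs. Words, on the other
  hand, are realized by arbitrary bypasses, and a word has a value only if the continuation exists.
  The permutation argument therefore keeps one concrete path: a germ is continued along the same
  bypass again and again, and a repetition among the finitely many germs yields a predecessor along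
  exactly this path. Existence of the iterates is the analytic core: branch points are defined by
  the monodromy of the matrix germ, whereas critical points come from the entries one at a time, so
  trivial monodromy at a critical point has to be used for all entries together.\<close>

definition germ_family ::
    "(real \<Rightarrow> complex) \<Rightarrow> real \<Rightarrow> real \<Rightarrow> (real \<Rightarrow> complex \<Rightarrow> complex) \<Rightarrow> bool" where
  "germ_family q a b \<Phi> \<longleftrightarrow> (\<forall>t\<in>{a..b}. \<Phi> t meromorphic_on {q t} \<and>
     (\<exists>\<delta>>0. \<forall>s\<in>{a..b}. dist s t < \<delta> \<longrightarrow> (\<forall>\<^sub>F z in at (q s). \<Phi> s z = \<Phi> t z)))"

lemma germ_familyI:
  assumes "\<And>t. t \<in> {a..b} \<Longrightarrow> \<Phi> t meromorphic_on {q t}"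
    and "\<And>t. t \<in> {a..b} \<Longrightarrow> \<exists>\<delta>>0. \<forall>s\<in>{a..b}. dist s t < \<delta> \<longrightarrow> (\<forall>\<^sub>F z in at (q s). \<Phi> s z = \<Phi> t z)"
  shows "germ_family q a b \<Phi>"
  using assms by (auto simp: germ_family_def)

lemma germ_family_meromorphic: "germ_family q a b \<Phi> \<Longrightarrow> t \<in> {a..b} \<Longrightarrow> \<Phi> t meromorphic_on {q t}"
  by (auto simp: germ_family_def)

lemma germ_family_local:
  assumes "germ_family q a b \<Phi>" "t \<in> {a..b}"
  obtains \<delta> where "\<delta> > 0" "\<And>s. s \<in> {a..b} \<Longrightarrow> dist s t < \<delta> \<Longrightarrow> \<forall>\<^sub>F z in at (q s). \<Phi> s z = \<Phi> t z"
  using assms unfolding germ_family_def by metis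

text \<open>The metric form is convenient for gluing, the filter form is the one in
  \<open>continues_along\<close>. They differ only at s = t, where the two germs coincide
  trivially.\<close>

lemma germ_family_iff_eventually:
  "germ_family q a b \<Phi> \<longleftrightarrow> (\<forall>t\<in>{a..b}. \<Phi> t meromorphic_on {q t}) \<and>
     (\<forall>t\<in>{a..b}. \<forall>\<^sub>F s in at t within {a..b}. \<forall>\<^sub>F z in at (q s). \<Phi> s z = \<Phi> t z)"
proof -
  have "(\<exists>\<delta>>0. \<forall>s\<in>{a..b}. dist s t < \<delta> \<longrightarrow> (\<forall>\<^sub>F z in at (q s). \<Phi> s z = \<Phi> t z)) \<longleftrightarrow>
      (\<forall>\<^sub>F s in at t within {a..b}. \<forall>\<^sub>F z in at (q s). \<Phi> s z = \<Phi> t z)" for t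
    unfolding eventually_at by (intro ex_cong1 conj_cong refl ball_cong) (metis always_eventually)
  then show ?thesis unfolding germ_family_def by auto
qed

lemma germ_family_const:
  assumes "f meromorphic_on q ` {a..b}"
  shows "germ_family q a b (\<lambda>_. f)"
  by (rule germ_familyI) (use assms meromorphic_on_subset in \<open>auto intro: gt_ex\<close>)

text \<open>Agreement of germs passes through any pointwise operation, whereas meromorphy of the
  result depends on \<open>H\<close> and is assumed. The argument z of \<open>H\<close> makes room
  for \<open>bi_poly P\<close>, whose coefficients vary with z.\<close>

lemma germ_family_map:
  assumes "germ_family q a b \<Phi>"
    and "\<And>t. t \<in> {a..b} \<Longrightarrow> (\<lambda>z. H z (\<Phi> t z)) meromorphic_on {q t}"
  shows "germ_family q a b (\<lambda>t z. H z (\<Phi> t z))"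
proof (rule germ_familyI)
  fix t assume t: "t \<in> {a..b}"
  obtain \<delta> where \<delta>: "\<delta> > 0" "\<And>s. s \<in> {a..b} \<Longrightarrow> dist s t < \<delta> \<Longrightarrow> \<forall>\<^sub>F z in at (q s). \<Phi> s z = \<Phi> t z"
    using germ_family_local[OF assms(1) t] by metis
  have "\<forall>s\<in>{a..b}. dist s t < \<delta> \<longrightarrow> (\<forall>\<^sub>F z in at (q s). H z (\<Phi> s z) = H z (\<Phi> t z))"
    by (intro ballI impI eventually_mono[OF \<delta>(2)]) auto
  with \<delta>(1) show "\<exists>\<delta>>0. \<forall>s\<in>{a..b}. dist s t < \<delta> \<longrightarrow>
      (\<forall>\<^sub>F z in at (q s). H z (\<Phi> s z) = H z (\<Phi> t z))" by blast
qed (use assms in auto)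

lemma germ_family_map2:
  assumes "germ_family q a b \<Phi>" "germ_family q a b \<Psi>"
    and "\<And>t. t \<in> {a..b} \<Longrightarrow> (\<lambda>z. H (\<Phi> t z) (\<Psi> t z)) meromorphic_on {q t}"
  shows "germ_family q a b (\<lambda>t z. H (\<Phi> t z) (\<Psi> t z))"
proof (rule germ_familyI)
  fix t assume t: "t \<in> {a..b}"
  obtain \<delta> where \<delta>: "\<delta> > 0" "\<And>s. s \<in> {a..b} \<Longrightarrow> dist s t < \<delta> \<Longrightarrow> \<forall>\<^sub>F z in at (q s). \<Phi> s z = \<Phi> t z"
    using germ_family_local[OF assms(1) t] by metis
  obtain \<epsilon> where \<epsilon>: "\<epsilon> > 0" "\<And>s. s \<in> {a..b} \<Longrightarrow> dist s t < \<epsilon> \<Longrightarrow> \<forall>\<^sub>F z in at (q s). \<Psi> s z = \<Psi> t z"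
    using germ_family_local[OF assms(2) t] by metis
  have "\<forall>s\<in>{a..b}. dist s t < min \<delta> \<epsilon> \<longrightarrow> (\<forall>\<^sub>F z in at (q s). H (\<Phi> s z) (\<Psi> s z) = H (\<Phi> t z) (\<Psi> t z))"
    by (auto intro: eventually_elim2[OF \<delta>(2) \<epsilon>(2)])
  with \<delta>(1) \<epsilon>(1) show "\<exists>\<delta>>0. \<forall>s\<in>{a..b}. dist s t < \<delta> \<longrightarrow>
      (\<forall>\<^sub>F z in at (q s). H (\<Phi> s z) (\<Psi> s z) = H (\<Phi> t z) (\<Psi> t z))"
    by (intro exI[of _ "min \<delta> \<epsilon>"]) auto
qed (use assms in auto)

lemma germ_family_mult:
  "germ_family q a b \<Phi> \<Longrightarrow> germ_family q a b \<Psi> \<Longrightarrow> germ_family q a b (\<lambda>t z. \<Phi> t z * \<Psi> t z)"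
  by (rule germ_family_map2) (auto intro!: meromorphic_intros dest: germ_family_meromorphic)

lemma germ_family_add:
  "germ_family q a b \<Phi> \<Longrightarrow> germ_family q a b \<Psi> \<Longrightarrow> germ_family q a b (\<lambda>t z. \<Phi> t z + \<Psi> t z)"
  by (rule germ_family_map2) (auto intro!: meromorphic_intros dest: germ_family_meromorphic)

lemma germ_family_diff:
  "germ_family q a b \<Phi> \<Longrightarrow> germ_family q a b \<Psi> \<Longrightarrow> germ_family q a b (\<lambda>t z. \<Phi> t z - \<Psi> t z)"
  by (rule germ_family_map2) (auto intro!: meromorphic_intros dest: germ_family_meromorphic)

lemma germ_family_sum:
  assumes "\<And>i. i \<in> I \<Longrightarrow> germ_family q a b (\<Phi> i)"
  shows "germ_family q a b (\<lambda>t z. \<Sum>i\<in>I. \<Phi> i t z)"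
  using assms
proof (induction I rule: infinite_finite_induct)
  case (insert i I)
  then show ?case using germ_family_add[of q a b "\<Phi> i"] by simp
qed (auto intro!: germ_family_const)

lemma germ_family_cong:
  assumes "germ_family q a b \<Phi>"
    and "\<And>t. t \<in> {a..b} \<Longrightarrow> q t = q' t" "\<And>t. t \<in> {a..b} \<Longrightarrow> \<Phi> t = \<Psi> t"
  shows "germ_family q' a b \<Psi>"
  using assms unfolding germ_family_def by simp

lemma germ_family_compose:
  assumes F: "germ_family q a b \<Phi>" and \<sigma>: "continuous_on {c..d} \<sigma>" "\<sigma> ` {c..d} \<subseteq> {a..b}"
  shows "germ_family (q \<circ> \<sigma>) c d (\<Phi> \<circ> \<sigma>)"
proof (rule germ_familyI)
  fix t assume t: "t \<in> {c..d}"
  then have \<sigma>t: "\<sigma> t \<in> {a..b}" using \<sigma>(2) t by blast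
  show "(\<Phi> \<circ> \<sigma>) t meromorphic_on {(q \<circ> \<sigma>) t}" using germ_family_meromorphic[OF F \<sigma>t] by simp
  obtain \<delta> where \<delta>: "\<delta> > 0" "\<And>s. s \<in> {a..b} \<Longrightarrow> dist s (\<sigma> t) < \<delta> \<Longrightarrow> \<forall>\<^sub>F z in at (q s). \<Phi> s z = \<Phi> (\<sigma> t) z"
    using germ_family_local[OF F \<sigma>t] by metis
  obtain \<eta> where "\<eta> > 0" "\<And>s. s \<in> {c..d} \<Longrightarrow> dist s t < \<eta> \<Longrightarrow> dist (\<sigma> s) (\<sigma> t) < \<delta>"
    using \<sigma>(1) t \<delta>(1) unfolding continuous_on_iff by metis
  then show "\<exists>\<delta>>0. \<forall>s\<in>{c..d}. dist s t < \<delta> \<longrightarrow> (\<forall>\<^sub>F z in at ((q \<circ> \<sigma>) s). (\<Phi> \<circ> \<sigma>) s z = (\<Phi> \<circ> \<sigma>) t z)"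
    using \<delta>(2) \<sigma>(2) by (intro exI[of _ \<eta>]) auto
qed

text \<open>A punctured open neighbourhood of x is open in a T1 space, so it is a neighbourhood of
  each of its points. This spreads agreement of two germs at one point of a path to all sufficiently
  close points.\<close>

lemma eventually_at_nearby:
  fixes x :: "'a::t1_space"
  assumes "\<forall>\<^sub>F z in at x. P z"
  obtains S where "open S" "x \<in> S" "\<And>y. y \<in> S \<Longrightarrow> \<forall>\<^sub>F z in at y. P z"
proof -
  obtain S where S: "open S" "x \<in> S" "\<And>z. z \<in> S - {x} \<Longrightarrow> P z"
    using assms unfolding eventually_at_topological by blast
  show ?thesis
  proof (rule that[OF S(1,2)])
    fix y assume y: "y \<in> S"
    show "\<forall>\<^sub>F z in at y. P z"
    proof (cases "y = x")
      case False
      have "\<forall>\<^sub>F z in nhds y. z \<in> S - {x}"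
        by (rule eventually_nhds_in_open) (use S False y in auto)
      then show ?thesis
        using S(3) by (intro filter_leD[OF at_within_le_nhds]) (auto elim: eventually_mono)
    qed (use assms in simp)
  qed
qed

text \<open>Only the junction t = b needs thought: to the right of b the members come from
  \<open>\<Psi>\<close>, and they must be compared with \<open>\<Phi> b\<close>. The two germs agree
  on a punctured neighbourhood of q b, and continuity of q keeps q s within its reach.\<close>

lemma germ_family_glue:
  assumes F: "germ_family q a b \<Phi>" and G: "germ_family q b c \<Psi>"
    and eq: "\<forall>\<^sub>F z in at (q b). \<Phi> b z = \<Psi> b z" and ab: "a \<le> b" "b \<le> c"
    and cont: "continuous_on {a..c} q"
  shows "germ_family q a c (\<lambda>t. if t \<le> b then \<Phi> t else \<Psi> t)"
proof (rule germ_familyI)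
  fix t assume t: "t \<in> {a..c}"
  show "(if t \<le> b then \<Phi> t else \<Psi> t) meromorphic_on {q t}"
    using t germ_family_meromorphic[OF F] germ_family_meromorphic[OF G] by auto
  consider "t < b" | "t = b" | "b < t" by linarith
  then show "\<exists>\<delta>>0. \<forall>s\<in>{a..c}. dist s t < \<delta> \<longrightarrow>
     (\<forall>\<^sub>F z in at (q s). (if s \<le> b then \<Phi> s else \<Psi> s) z = (if t \<le> b then \<Phi> t else \<Psi> t) z)"
  proof cases
    case 1
    then have "t \<in> {a..b}" using t by auto
    from germ_family_local[OF F this] obtain \<delta> where \<delta>: "\<delta> > 0"
      "\<And>s. s \<in> {a..b} \<Longrightarrow> dist s t < \<delta> \<Longrightarrow> \<forall>\<^sub>F z in at (q s). \<Phi> s z = \<Phi> t z" by metis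
    show ?thesis
    proof (intro exI[of _ "min \<delta> (b - t)"] conjI ballI impI)
      fix s assume "s \<in> {a..c}" "dist s t < min \<delta> (b - t)"
      then have "s \<in> {a..b}" "dist s t < \<delta>" by (auto simp: dist_real_def)
      from \<delta>(2)[OF this] \<open>s \<in> {a..b}\<close> 1
      show "\<forall>\<^sub>F z in at (q s). (if s \<le> b then \<Phi> s else \<Psi> s) z = (if t \<le> b then \<Phi> t else \<Psi> t) z"
        by simp
    qed (use \<delta> 1 in auto)
  next
    case 2
    then have "t \<in> {a..b}" "t \<in> {b..c}" using t by auto
    from germ_family_local[OF F this(1)] obtain \<delta> where \<delta>: "\<delta> > 0"
      "\<And>s. s \<in> {a..b} \<Longrightarrow> dist s t < \<delta> \<Longrightarrow> \<forall>\<^sub>F z in at (q s). \<Phi> s z = \<Phi> t z" by metis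
    from germ_family_local[OF G \<open>t \<in> {b..c}\<close>] obtain \<epsilon> where \<epsilon>: "\<epsilon> > 0"
      "\<And>s. s \<in> {b..c} \<Longrightarrow> dist s t < \<epsilon> \<Longrightarrow> \<forall>\<^sub>F z in at (q s). \<Psi> s z = \<Psi> t z" by metis
    obtain S where S: "open S" "q t \<in> S" "\<And>y. y \<in> S \<Longrightarrow> \<forall>\<^sub>F z in at y. \<Phi> t z = \<Psi> t z"
      using eventually_at_nearby[OF eq] 2 by metis
    then obtain \<rho> where "\<rho> > 0" and \<rho>: "ball (q t) \<rho> \<subseteq> S" using openE by blast
    obtain \<eta> where \<eta>: "\<eta> > 0" "\<And>s. s \<in> {a..c} \<Longrightarrow> dist s t < \<eta> \<Longrightarrow> dist (q s) (q t) < \<rho>"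
      using cont t \<open>\<rho> > 0\<close> unfolding continuous_on_iff by metis
    show ?thesis
    proof (intro exI[of _ "min \<delta> (min \<epsilon> \<eta>)"] conjI ballI impI)
      fix s assume s: "s \<in> {a..c}" "dist s t < min \<delta> (min \<epsilon> \<eta>)"
      show "\<forall>\<^sub>F z in at (q s). (if s \<le> b then \<Phi> s else \<Psi> s) z = (if t \<le> b then \<Phi> t else \<Psi> t) z"
      proof (cases "s \<le> b")
        case True
        then show ?thesis using \<delta>(2)[of s] s 2 by auto
      next
        case False
        have "q s \<in> S" using \<eta>(2)[of s] \<rho> s by (auto simp: dist_commute)
        from S(3)[OF \<open>q s \<in> S\<close>] have "\<forall>\<^sub>F z in at (q s). \<Phi> t z = \<Psi> t z" .
        moreover have "\<forall>\<^sub>F z in at (q s). \<Psi> s z = \<Psi> t z" using \<epsilon>(2)[of s] s False by auto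
        ultimately show ?thesis using False 2 by (auto elim: eventually_elim2)
      qed
    qed (use \<delta> \<epsilon> \<eta> in auto)
  next
    case 3
    then have "t \<in> {b..c}" using t by auto
    from germ_family_local[OF G this] obtain \<delta> where \<delta>: "\<delta> > 0"
      "\<And>s. s \<in> {b..c} \<Longrightarrow> dist s t < \<delta> \<Longrightarrow> \<forall>\<^sub>F z in at (q s). \<Psi> s z = \<Psi> t z" by metis
    show ?thesis
    proof (intro exI[of _ "min \<delta> (t - b)"] conjI ballI impI)
      fix s assume "s \<in> {a..c}" "dist s t < min \<delta> (t - b)"
      then have "s \<in> {b..c}" "b < s" "dist s t < \<delta>" by (auto simp: dist_real_def)
      from \<delta>(2)[OF this(1,3)] \<open>b < s\<close> 3
      show "\<forall>\<^sub>F z in at (q s). (if s \<le> b then \<Phi> s else \<Psi> s) z = (if t \<le> b then \<Phi> t else \<Psi> t) z"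
        by simp
    qed (use \<delta> 3 in auto)
  qed
qed

section \<open>The identity principle along a path\<close>

lemma meromorphic_on_eventually_zero_or_nonzero:
  assumes "f meromorphic_on {z}"
  shows "(\<forall>\<^sub>F w in at z. f w = 0) \<or> (\<forall>\<^sub>F w in at z. f w \<noteq> 0)"
  using assms not_essential_frequently_0_imp_eventually_0[of f z]
  by (auto simp: meromorphic_at_iff frequently_def)

text \<open>Whether the germ at time t vanishes is a locally constant property of t, and the
  parameter interval is connected.\<close>

lemma germ_family_zero_iff:
  assumes F: "germ_family q a b \<Phi>" and cont: "continuous_on {a..b} q" and "a \<le> b"
  shows "(\<forall>\<^sub>F z in at (q a). \<Phi> a z = 0) \<longleftrightarrow> (\<forall>\<^sub>F z in at (q b). \<Phi> b z = 0)"
proof -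
  let ?Z = "\<lambda>t. \<forall>\<^sub>F z in at (q t). \<Phi> t z = 0"
  have "\<forall>\<^sub>F s in at t within {a..b}. ?Z t = ?Z s" if t: "t \<in> {a..b}" for t
  proof -
    obtain \<delta> where \<delta>: "\<delta> > 0" "\<And>s. s \<in> {a..b} \<Longrightarrow> dist s t < \<delta> \<Longrightarrow> \<forall>\<^sub>F z in at (q s). \<Phi> s z = \<Phi> t z"
      using germ_family_local[OF F t] by metis
    \<comment> \<open>Zeros of a meromorphic germ do not accumulate unless it vanishes identically.
      Hence both vanishing and non-vanishing spread to all centres y near q t.\<close>
    have "\<exists>S. open S \<and> q t \<in> S \<and> (\<forall>y\<in>S. (\<forall>\<^sub>F z in at y. \<Phi> t z = 0) \<longleftrightarrow> ?Z t)"
    proof (cases "?Z t")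
      case True
      from eventually_at_nearby[OF this] show ?thesis using True by metis
    next
      case False
      then have "\<forall>\<^sub>F z in at (q t). \<Phi> t z \<noteq> 0"
        using meromorphic_on_eventually_zero_or_nonzero[OF germ_family_meromorphic[OF F t]] by auto
      then obtain S where S: "open S" "q t \<in> S" "\<And>y. y \<in> S \<Longrightarrow> \<forall>\<^sub>F z in at y. \<Phi> t z \<noteq> 0"
        by (elim eventually_at_nearby) blast
      have "\<not> (\<forall>\<^sub>F z in at y. \<Phi> t z = 0)" if "y \<in> S" for y
      proof
        assume "\<forall>\<^sub>F z in at y. \<Phi> t z = 0"
        with S(3)[OF that] have "\<forall>\<^sub>F z in at y. False" by eventually_elim simp
        then show False by simp
      qed
      with S False show ?thesis by blast
    qed
    then obtain S where S: "open S" "q t \<in> S" "\<And>y. y \<in> S \<Longrightarrow> (\<forall>\<^sub>F z in at y. \<Phi> t z = 0) \<longleftrightarrow> ?Z t"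
      by blast
    have "\<forall>\<^sub>F s in at t within {a..b}. q s \<in> S"
      using cont t S by (auto simp: continuous_on_def dest: topological_tendstoD)
    moreover have "\<forall>\<^sub>F s in at t within {a..b}. s \<in> {a..b} \<and> dist s t < \<delta>"
      using \<delta>(1) by (auto simp: eventually_at)
    ultimately show ?thesis
    proof eventually_elim
      case (elim s)
      have "\<forall>\<^sub>F z in at (q s). \<Phi> s z = \<Phi> t z" using \<delta>(2) elim by blast
      then have "?Z s \<longleftrightarrow> (\<forall>\<^sub>F z in at (q s). \<Phi> t z = 0)" by (intro eventually_subst) (auto elim: eventually_mono)
      with S(3) elim show ?case by blast
    qed
  qed
  then show ?thesis
    using connected_local_const[of "{a..b}" a b ?Z] \<open>a \<le> b\<close> by auto
qed

lemma germ_family_eq_iff: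
  assumes "germ_family q a b \<Phi>" "germ_family q a b \<Psi>" "continuous_on {a..b} q" "a \<le> b"
  shows "(\<forall>\<^sub>F z in at (q a). \<Phi> a z = \<Psi> a z) \<longleftrightarrow> (\<forall>\<^sub>F z in at (q b). \<Phi> b z = \<Psi> b z)"
  using germ_family_zero_iff[OF germ_family_diff[OF assms(1,2)] assms(3,4)] by simp

section \<open>Germs of meromorphic matrix functions and their continuation\<close>

lemma eventually_all_iff:
  "(\<forall>\<^sub>F x in F. \<forall>y::'b::finite. P x y) \<longleftrightarrow> (\<forall>y. \<forall>\<^sub>F x in F. P x y)"
  using eventually_ball_finite_distrib[of "UNIV :: 'b set" P F] by simp

lemma same_germ_refl [simp]: "same_germ k f f"
  by (simp add: same_germ_def)

lemma same_germ_sym: "same_germ k f g \<Longrightarrow> same_germ k g f"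
  by (auto simp: same_germ_def eq_commute)

lemma same_germ_trans [trans]: "same_germ k f g \<Longrightarrow> same_germ k g h \<Longrightarrow> same_germ k f h"
  unfolding same_germ_def by (auto elim: eventually_elim2)

lemma same_germ_entrywise:
  fixes f g :: "('n::finite) matrix_fun"
  shows "same_germ k f g \<longleftrightarrow> (\<forall>i j. \<forall>\<^sub>F z in at k. f z $ i $ j = g z $ i $ j)"
  by (simp add: same_germ_def vec_eq_iff eventually_all_iff)

definition meromorphic_matrix_on :: "('n::finite) matrix_fun \<Rightarrow> complex set \<Rightarrow> bool" where
  "meromorphic_matrix_on f S \<longleftrightarrow> (\<forall>i j. (\<lambda>z. f z $ i $ j) meromorphic_on S)"

lemma meromorphic_matrix_on_cong:
  fixes f :: "('n::finite) matrix_fun"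
  assumes "same_germ k f g"
  shows "meromorphic_matrix_on f {k} \<longleftrightarrow> meromorphic_matrix_on g {k}"
proof -
  have "(\<lambda>z. f z $ i $ j) meromorphic_on {k} \<longleftrightarrow> (\<lambda>z. g z $ i $ j) meromorphic_on {k}" for i j
    using assms by (intro meromorphic_on_cong) (auto simp: same_germ_entrywise)
  then show ?thesis by (simp add: meromorphic_matrix_on_def)
qed

lemma meromorphic_matrix_on_eventually:
  fixes f :: "('n::finite) matrix_fun"
  assumes "meromorphic_matrix_on f {k}"
  shows "\<forall>\<^sub>F z in at k. \<forall>i j. (\<lambda>w. f w $ i $ j) analytic_on {z}"
  using assms meromorphic_on_imp_not_islimpt_singularities[of _ "{k}" k]
  by (auto simp: meromorphic_matrix_on_def eventually_all_iff islimpt_conv_frequently_at frequently_def)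

text \<open>Singularities of a meromorphic germ are isolated, so nearby centres are regular. The
  ball obtained allows the germ to be continued as itself along short segments.\<close>

lemma meromorphic_matrix_on_nhd:
  fixes f :: "('n::finite) matrix_fun"
  assumes "meromorphic_matrix_on f {k}"
  obtains r where "r > 0" "meromorphic_matrix_on f (ball k r)"
proof -
  have "\<forall>\<^sub>F z in at k. meromorphic_matrix_on f {z}"
    using meromorphic_matrix_on_eventually[OF assms]
    by eventually_elim (auto simp: meromorphic_matrix_on_def intro: analytic_on_imp_meromorphic_on)
  with assms have "\<forall>\<^sub>F z in nhds k. meromorphic_matrix_on f {z}"
    by (simp add: eventually_nhds_conv_at)
  then obtain r where "r > 0" "\<And>z. dist z k < r \<Longrightarrow> meromorphic_matrix_on f {z}"
    unfolding eventually_nhds_metric by blast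
  then show ?thesis
    by (intro that[of r])
       (auto simp: meromorphic_matrix_on_def meromorphic_on_def dist_commute)
qed

definition matrix_germ_family ::
    "(real \<Rightarrow> complex) \<Rightarrow> real \<Rightarrow> real \<Rightarrow> (real \<Rightarrow> ('n::finite) matrix_fun) \<Rightarrow> bool" where
  "matrix_germ_family q a b F \<longleftrightarrow> (\<forall>i j. germ_family q a b (\<lambda>t z. F t z $ i $ j))"

lemma matrix_germ_familyI:
  "(\<And>i j. germ_family q a b (\<lambda>t z. (F :: real \<Rightarrow> ('n::finite) matrix_fun) t z $ i $ j)) \<Longrightarrow>
     matrix_germ_family q a b F"
  by (simp add: matrix_germ_family_def)

lemma matrix_germ_familyD:
  "matrix_germ_family q a b F \<Longrightarrow>
     germ_family q a b (\<lambda>t z. (F :: real \<Rightarrow> ('n::finite) matrix_fun) t z $ i $ j)"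
  by (simp add: matrix_germ_family_def)

lemma matrix_germ_family_iff_eventually:
  "matrix_germ_family q a b F \<longleftrightarrow> (\<forall>t\<in>{a..b}. meromorphic_matrix_on (F t) {q t}) \<and>
     (\<forall>t\<in>{a..b}. \<forall>\<^sub>F s in at t within {a..b}. same_germ (q s) (F s) (F t))"
  unfolding matrix_germ_family_def germ_family_iff_eventually meromorphic_matrix_on_def
    same_germ_entrywise eventually_all_iff by blast

lemma continues_along_iff:
  "continues_along p f g \<longleftrightarrow> path p \<and> (\<exists>F. matrix_germ_family p 0 1 F \<and>
     same_germ (pathstart p) (F 0) f \<and> same_germ (pathfinish p) (F 1) g)"
  unfolding continues_along_def matrix_germ_family_iff_eventually meromorphic_matrix_on_def conj_assoc ..

lemma continues_alongI:
  assumes "path p" "matrix_germ_family p 0 1 F"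
    and "same_germ (pathstart p) (F 0) f" "same_germ (pathfinish p) (F 1) g"
  shows "continues_along p f g"
  using assms continues_along_iff by blast

lemma continues_alongE:
  assumes "continues_along p f g"
  obtains F where "path p" "matrix_germ_family p 0 1 F"
    "same_germ (pathstart p) (F 0) f" "same_germ (pathfinish p) (F 1) g"
  using assms continues_along_iff by blast

lemma continues_along_meromorphic:
  assumes "continues_along p f g"
  shows "meromorphic_matrix_on f {pathstart p}" "meromorphic_matrix_on g {pathfinish p}"
proof -
  obtain F where F: "matrix_germ_family p 0 1 F"
    "same_germ (pathstart p) (F 0) f" "same_germ (pathfinish p) (F 1) g"
    using assms by (elim continues_alongE)
  have "meromorphic_matrix_on (F t) {p t}" if "t \<in> {0..1}" for t
    using germ_family_meromorphic[OF matrix_germ_familyD[OF F(1)] that] by (auto simp: meromorphic_matrix_on_def)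
  from this[of 0] this[of 1] show "meromorphic_matrix_on f {pathstart p}" "meromorphic_matrix_on g {pathfinish p}"
    using meromorphic_matrix_on_cong[OF F(2)] meromorphic_matrix_on_cong[OF F(3)]
    by (auto simp: pathstart_def pathfinish_def)
qed

lemma continues_along_cong:
  assumes "continues_along p f g" "same_germ (pathstart p) f f'" "same_germ (pathfinish p) g g'"
  shows "continues_along p f' g'"
  using assms unfolding continues_along_def by (meson same_germ_trans)

text \<open>A function that is single-valued along the path continues to itself, by the constant
  family. In this way the factors are carried along bypasses inside their half-planes.\<close>

lemma continues_along_const:
  assumes "path p" "meromorphic_matrix_on f (path_image p)"
  shows "continues_along p f f"
  using assms
  by (intro continues_alongI[where F = "\<lambda>_. f"] matrix_germ_familyI germ_family_const)
     (auto simp: meromorphic_matrix_on_def path_image_def)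

text \<open>Both families represent g at the junction, so after halving the parameter intervals they
  can be glued.\<close>

lemma continues_along_join:
  assumes "continues_along p f g" "continues_along q g h" "pathfinish p = pathstart q"
  shows "continues_along (p +++ q) f h"
proof -
  obtain F where F: "path p" "matrix_germ_family p 0 1 F"
    "same_germ (pathstart p) (F 0) f" "same_germ (pathfinish p) (F 1) g"
    using assms(1) by (elim continues_alongE)
  obtain H where H: "path q" "matrix_germ_family q 0 1 H"
    "same_germ (pathstart q) (H 0) g" "same_germ (pathfinish q) (H 1) h"
    using assms(2) by (elim continues_alongE)
  let ?F = "\<lambda>t. if t \<le> 1/2 then F (2 * t) else H (2 * t - 1)"
  have pq: "path (p +++ q)" using F H assms by simp
  have FH: "same_germ (q 0) (F 1) (H 0)"
    using F(4) same_germ_sym[OF H(3)] assms(3) by (auto simp: pathstart_def intro: same_germ_trans)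
  show ?thesis
  proof (rule continues_alongI[where F = ?F])
    show "matrix_germ_family (p +++ q) 0 1 ?F"
    proof (rule matrix_germ_familyI)
      fix i j
      have 1: "germ_family (p +++ q) 0 (1/2) (\<lambda>t z. F (2 * t) z $ i $ j)"
        using germ_family_compose[OF matrix_germ_familyD[OF F(2)], of 0 "1/2" "\<lambda>t. 2 * t" i j]
        by (auto intro!: continuous_intros simp: joinpaths_def o_def elim!: germ_family_cong)
      have "germ_family (q \<circ> (\<lambda>t. 2 * t - 1)) (1/2) 1 ((\<lambda>t z. H t z $ i $ j) \<circ> (\<lambda>t. 2 * t - 1))"
        by (rule germ_family_compose[OF matrix_germ_familyD[OF H(2)]]) (auto intro!: continuous_intros)
      then have 2: "germ_family (p +++ q) (1/2) 1 (\<lambda>t z. H (2 * t - 1) z $ i $ j)"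
        using assms(3) by (elim germ_family_cong)
          (auto simp: joinpaths_def pathfinish_def pathstart_def field_simps)
      have "germ_family (p +++ q) 0 1
          (\<lambda>t. if t \<le> 1/2 then (\<lambda>z. F (2 * t) z $ i $ j) else (\<lambda>z. H (2 * t - 1) z $ i $ j))"
        using FH pq assms(3) by (intro germ_family_glue[OF 1 2])
          (auto simp: joinpaths_def path_def same_germ_entrywise pathfinish_def pathstart_def)
      then show "germ_family (p +++ q) 0 1 (\<lambda>t z. ?F t z $ i $ j)"
        by (elim germ_family_cong) auto
    qed
  qed (use F H pq in auto)
qed

lemma path_continuous: "path p \<Longrightarrow> continuous_on {0..1} p"
  by (simp add: path_def)

text \<open>The identity principle for the difference of two families, read in both directions:
  forwards it is uniqueness of the continuation, backwards its injectivity. The latter drives the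
  permutation of branches.\<close>

lemma continues_along_same_germ_iff:
  assumes "continues_along p f g" "continues_along p f' g'"
  shows "same_germ (pathstart p) f f' \<longleftrightarrow> same_germ (pathfinish p) g g'"
proof -
  obtain F where F: "path p" "matrix_germ_family p 0 1 F"
    "same_germ (pathstart p) (F 0) f" "same_germ (pathfinish p) (F 1) g"
    using assms(1) by (elim continues_alongE)
  obtain H where H: "matrix_germ_family p 0 1 H"
    "same_germ (pathstart p) (H 0) f'" "same_germ (pathfinish p) (H 1) g'"
    using assms(2) by (elim continues_alongE)
  have "same_germ (pathstart p) (F 0) (H 0) \<longleftrightarrow> same_germ (pathfinish p) (F 1) (H 1)"
    unfolding same_germ_entrywise pathstart_def pathfinish_def
    using germ_family_eq_iff[OF matrix_germ_familyD[OF F(2)] matrix_germ_familyD[OF H(1)] path_continuous[OF F(1)]] by simp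
  then show ?thesis using F(3,4) H(2,3) by (meson same_germ_trans same_germ_sym)
qed

definition germs_commute :: "complex \<Rightarrow> ('n::finite) matrix_fun \<Rightarrow> 'n matrix_fun \<Rightarrow> bool" where
  "germs_commute k f g \<longleftrightarrow> (\<forall>\<^sub>F z in at k. f z ** g z = g z ** f z)"

lemma germs_commute_cong:
  assumes "same_germ k f f'" "same_germ k g g'"
  shows "germs_commute k f g \<longleftrightarrow> germs_commute k f' g'"
proof -
  from assms have "\<forall>\<^sub>F z in at k. (f z ** g z = g z ** f z) = (f' z ** g' z = g' z ** f' z)"
    unfolding same_germ_def by eventually_elim simp
  then show ?thesis unfolding germs_commute_def by (rule eventually_subst)
qed

text \<open>The entries of both products are sums of products of germs, hence again germ families.
  Commutation is thus an algebraic relation that persists under continuation.\<close>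

lemma continues_along_commute_iff:
  assumes "continues_along p f g" "continues_along p f' g'"
  shows "germs_commute (pathstart p) f f' \<longleftrightarrow> germs_commute (pathfinish p) g g'"
proof -
  obtain F where F: "path p" "matrix_germ_family p 0 1 F"
    "same_germ (pathstart p) (F 0) f" "same_germ (pathfinish p) (F 1) g"
    using assms(1) by (elim continues_alongE)
  obtain H where H: "matrix_germ_family p 0 1 H"
    "same_germ (pathstart p) (H 0) f'" "same_germ (pathfinish p) (H 1) g'"
    using assms(2) by (elim continues_alongE)
  have "germ_family p 0 1 (\<lambda>t z. (F t z ** H t z) $ i $ j)"
       "germ_family p 0 1 (\<lambda>t z. (H t z ** F t z) $ i $ j)" for i j
    by (auto simp: matrix_matrix_mult_def intro!: germ_family_sum germ_family_mult matrix_germ_familyD F H)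
  from germ_family_eq_iff[OF this path_continuous[OF F(1)]]
  have "germs_commute (pathstart p) (F 0) (H 0) \<longleftrightarrow> germs_commute (pathfinish p) (F 1) (H 1)"
    by (simp add: germs_commute_def vec_eq_iff eventually_all_iff pathstart_def pathfinish_def)
  then show ?thesis
    using germs_commute_cong[OF F(3) H(2)] germs_commute_cong[OF F(4) H(3)] by simp
qed

section \<open>Minimal polynomials and the algebraic curve\<close>

definition bi_poly :: "'a::comm_ring_1 poly poly \<Rightarrow> 'a \<Rightarrow> 'a \<Rightarrow> 'a" where
  "bi_poly P z w = poly (poly P [:w:]) z"

text \<open>Fixing z leaves a univariate polynomial in w, to which factorization into linear factors
  over the complex numbers applies.\<close>

definition slice :: "'a::comm_ring_1 poly poly \<Rightarrow> 'a \<Rightarrow> 'a poly" where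
  "slice P z = map_poly (\<lambda>c. poly c z) P"

lemma coeff_slice [simp]: "coeff (slice P z) n = poly (coeff P n) z"
  by (simp add: slice_def coeff_map_poly)

lemma bi_poly_altdef: "bi_poly P z w = (\<Sum>i\<le>degree P. poly (coeff P i) z * w ^ i)"
  by (simp add: bi_poly_def poly_altdef[of P] poly_sum poly_power)

lemma degree_slice_le: "degree (slice P z) \<le> degree P"
  by (rule degree_le) (auto simp: coeff_eq_0)

lemma poly_slice [simp]: "poly (slice P z) w = bi_poly P z w"
proof -
  \<comment> \<open>The degree of the slice drops where the leading coefficient vanishes; the
    surplus terms of the longer sum are zero.\<close>
  have "poly (coeff P i) z = 0" if "degree (slice P z) < i" for i
    using coeff_eq_0[OF that] by simp
  then show ?thesis
    unfolding poly_altdef[of "slice P z"] bi_poly_altdef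
    using degree_slice_le[of P z] by (intro sum.mono_neutral_cong_left) auto
qed

lemma bi_poly_simps [simp]:
  "bi_poly (P + Q) z w = bi_poly P z w + bi_poly Q z w"
  "bi_poly (P - Q) z w = bi_poly P z w - bi_poly Q z w"
  "bi_poly (P * Q) z w = bi_poly P z w * bi_poly Q z w"
  "bi_poly [:c:] z w = poly c z"
  "bi_poly (smult c P) z w = poly c z * bi_poly P z w"
  by (simp_all add: bi_poly_def)

lemma pderiv_slice: "pderiv (slice P z) = slice (pderiv P) z"
  by (rule poly_eqI) (simp add: coeff_pderiv)

lemma analytic_on_poly: "(\<lambda>z. poly p z) analytic_on A"
  by (induction p) (auto intro!: analytic_intros)

lemma meromorphic_on_poly: "(\<lambda>z. poly p z) meromorphic_on A"
  by (intro analytic_on_imp_meromorphic_on analytic_on_poly)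

lemma meromorphic_on_bi_poly:
  "f meromorphic_on A \<Longrightarrow> (\<lambda>z. bi_poly P z (f z)) meromorphic_on A"
  unfolding bi_poly_altdef
  by (intro meromorphic_intros meromorphic_on_poly)

text \<open>Where the leading coefficient vanishes a root may escape to infinity; where P and its
  derivative in w have a common root, roots collide. These points are the only candidates for poles
  and for ramification of a root.\<close>

definition critical_points :: "complex poly poly \<Rightarrow> complex set" where
  "critical_points P = {z. poly (lead_coeff P) z = 0 \<or>
     (\<exists>w. bi_poly P z w = 0 \<and> bi_poly (pderiv P) z w = 0)}"

text \<open>The ideal of P and its derivative contains a nonzero polynomial in the first variable:
  a nonzero element of least degree divides multiples of both, and minimality of P
  makes its degree 0.\<close>

lemma algebraic_germ_minimal_poly:
  fixes f :: "complex \<Rightarrow> complex"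
  assumes f: "f meromorphic_on {k}" and "P0 \<noteq> 0" "\<forall>\<^sub>F z in at k. bi_poly P0 z (f z) = 0"
  obtains P where "degree P > 0" "\<forall>\<^sub>F z in at k. bi_poly P z (f z) = 0" "finite (critical_points P)"
proof -
  let ?ann = "\<lambda>P. P \<noteq> 0 \<and> (\<forall>\<^sub>F z in at k. bi_poly P z (f z) = 0)"
  obtain P where P: "?ann P" and min: "\<And>Q. ?ann Q \<Longrightarrow> degree P \<le> degree Q"
    using ex_has_least_nat[of ?ann P0 degree] assms by blast
  have deg: "degree P > 0"
  proof (rule ccontr)
    assume "\<not> ?thesis"
    then obtain c where c: "P = [:c:]" using degree_eq_zeroE by blast
    with P have zero: "\<forall>\<^sub>F z in at k. poly c z = 0" and "c \<noteq> 0" by auto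
    have "\<forall>\<^sub>F z in at k. poly c z \<noteq> 0"
      using poly_roots_finite[OF \<open>c \<noteq> 0\<close>] islimpt_finite[of "{z. poly c z = 0}" k]
      by (auto simp: islimpt_conv_frequently_at frequently_def)
    with zero have "\<forall>\<^sub>F z in at k. False" by eventually_elim simp
    then show False by simp
  qed
  let ?I = "\<lambda>d. d \<noteq> 0 \<and> (\<exists>A B. d = A * P + B * pderiv P)"
  have pd: "?I (pderiv P)"
    using deg by (auto simp: pderiv_eq_0_iff intro: exI[of _ 0] exI[of _ 1])
  then obtain d where d: "?I d" and dmin: "\<And>e. ?I e \<Longrightarrow> degree d \<le> degree e"
    using ex_has_least_nat[of ?I "pderiv P" degree] by blast
  obtain A B where AB: "d = A * P + B * pderiv P" using d by blast
  have "degree d = 0"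
  proof -
    \<comment> \<open>The coefficients lie in a polynomial ring and not in a field, so division with
      remainder by d requires multiplying P by a nonzero a first. The remainder stays in the ideal,
      and least degree of d makes it zero.\<close>
    obtain a q where aq: "a \<noteq> 0" "smult a P = d * q + pseudo_mod P d"
      using pseudo_mod(1)[of d P] d by auto
    have "pseudo_mod P d = ([:a:] - A * q) * P + (- (B * q)) * pderiv P"
      using aq(2) AB by (simp add: algebra_simps)
    then have "pseudo_mod P d \<noteq> 0 \<Longrightarrow> degree d \<le> degree (pseudo_mod P d)"
      using dmin by blast
    then have "pseudo_mod P d = 0"
      using pseudo_mod(2)[of d P] d by linarith
    then have eq: "smult a P = d * q" using aq by simp
    have "d \<noteq> 0" "q \<noteq> 0" using eq aq P d by auto
    have degs: "degree P = degree d + degree q"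
      using arg_cong[OF eq, of degree] aq(1) \<open>d \<noteq> 0\<close> \<open>q \<noteq> 0\<close> by (simp add: degree_mult_eq)
    have "degree d \<le> degree (pderiv P)" using dmin[OF pd] .
    then have "degree d < degree P" using deg by (simp add: degree_pderiv)
    \<comment> \<open>Since d has smaller degree than P, it cannot annihilate f. Its cofactor q must
      do so instead, and minimality of P against q leaves degree 0 for d.\<close>
    then have "\<not> (\<forall>\<^sub>F z in at k. bi_poly d z (f z) = 0)"
      using min[of d] \<open>d \<noteq> 0\<close> by linarith
    then have nz: "\<forall>\<^sub>F z in at k. bi_poly d z (f z) \<noteq> 0"
      using meromorphic_on_eventually_zero_or_nonzero[OF meromorphic_on_bi_poly[OF f]] by blast
    have prod: "bi_poly d z w * bi_poly q z w = poly a z * bi_poly P z w" for z w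
      using arg_cong[OF eq, of "\<lambda>P. bi_poly P z w"] by simp
    from P have "\<forall>\<^sub>F z in at k. bi_poly d z (f z) * bi_poly q z (f z) = 0"
      unfolding prod by (auto elim: eventually_mono)
    with nz have "\<forall>\<^sub>F z in at k. bi_poly q z (f z) = 0"
      by eventually_elim auto
    then have "degree P \<le> degree q" using min[of q] \<open>q \<noteq> 0\<close> by blast
    then show ?thesis using degs by simp
  qed
  then obtain c where c: "d = [:c:]" using degree_eq_zeroE by blast
  with d have "c \<noteq> 0" by auto
  \<comment> \<open>Now d is a nonzero polynomial c in z alone, and a common zero of P and its
    derivative above z forces c to vanish at z. So c plays the part of the discriminant.\<close>
  have "critical_points P \<subseteq> {z. poly (lead_coeff P) z = 0} \<union> {z. poly c z = 0}"
  proof -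
    have "poly c z = 0" if "bi_poly P z w = 0" "bi_poly (pderiv P) z w = 0" for z w
      using arg_cong[OF AB, of "\<lambda>P. bi_poly P z w"] c that by simp
    then show ?thesis by (auto simp: critical_points_def)
  qed
  moreover have "finite ({z. poly (lead_coeff P) z = 0} \<union> {z. poly c z = 0})"
    using P \<open>c \<noteq> 0\<close> by (simp add: poly_roots_finite)
  ultimately have "finite (critical_points P)" by (rule finite_subset)
  then show ?thesis using that[OF deg] P by blast
qed

lemma continuous_bi_poly:
  fixes P :: "complex poly poly"
  assumes "(f \<longlongrightarrow> a) F" "(g \<longlongrightarrow> b) F"
  shows "((\<lambda>x. bi_poly P (f x) (g x)) \<longlongrightarrow> bi_poly P a b) F"
  unfolding bi_poly_altdef using assms by (intro tendsto_intros tendsto_poly) auto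

lemma degree_slice:
  fixes P :: "complex poly poly"
  assumes "poly (lead_coeff P) z \<noteq> 0"
  shows "degree (slice P z) = degree P"
  using degree_slice_le[of P z] le_degree[of "slice P z" "degree P"] assms by auto

text \<open>In the factorization into linear factors, each factor at w is a distance to a root,
  hence at least \<eta>.\<close>

lemma norm_poly_ge:
  fixes p :: "complex poly"
  assumes "\<And>r. poly p r = 0 \<Longrightarrow> \<eta> \<le> dist r w" "0 \<le> \<eta>"
  shows "norm (lead_coeff p) * \<eta> ^ degree p \<le> norm (poly p w)"
proof (cases "p = 0")
  case False
  obtain root where root: "smult (lead_coeff p) (\<Prod>i<degree p. [:-root i, 1:]) = p"
    by (rule complex_poly_decompose')
  have eval: "poly p x = lead_coeff p * (\<Prod>i<degree p. x - root i)" for x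
    by (subst root[symmetric]) (simp add: poly_prod)
  have "poly p (root i) = 0" if "i < degree p" for i
    using that by (auto simp: eval)
  then have "\<eta> ^ degree p \<le> (\<Prod>i<degree p. norm (w - root i))"
    using assms prod_mono[of "{..<degree p}" "\<lambda>_. \<eta>" "\<lambda>i. norm (w - root i)"]
    by (fastforce simp: dist_norm norm_minus_commute)
  then have "norm (lead_coeff p) * \<eta> ^ degree p \<le> norm (lead_coeff p) * norm (\<Prod>i<degree p. w - root i)"
    by (intro mult_left_mono) (auto simp: prod_norm)
  then show ?thesis by (simp add: eval norm_mult)
qed auto

text \<open>A ball of radius \<eta> without roots over z would keep |P(z, w0)| above |c(z)|
  \<eta>^n, with c the leading coefficient and n the degree. At z0 the left side is 0 and the right
  side positive, so by continuity this fails for all z near z0. The argument also covers multiple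
  roots.\<close>

lemma eventually_root_near:
  fixes P :: "complex poly poly"
  assumes "poly (lead_coeff P) z0 \<noteq> 0" "bi_poly P z0 w0 = 0" "\<eta> > 0"
  shows "\<forall>\<^sub>F z in nhds z0. \<exists>w\<in>ball w0 \<eta>. bi_poly P z w = 0"
proof -
  let ?n = "degree P"
  have "((\<lambda>z. norm (poly (lead_coeff P) z) * \<eta> ^ ?n - norm (bi_poly P z w0)) \<longlongrightarrow>
      norm (poly (lead_coeff P) z0) * \<eta> ^ ?n - norm (bi_poly P z0 w0)) (nhds z0)"
    by (intro tendsto_intros continuous_bi_poly tendsto_poly) (auto simp: filterlim_ident)
  moreover have "norm (poly (lead_coeff P) z0) * \<eta> ^ ?n - norm (bi_poly P z0 w0) > 0"
    using assms by simp
  ultimately have "\<forall>\<^sub>F z in nhds z0. norm (poly (lead_coeff P) z) * \<eta> ^ ?n - norm (bi_poly P z w0) > 0"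
    by (rule order_tendstoD)
  then show ?thesis
  proof eventually_elim
    case (elim z)
    then have "poly (lead_coeff P) z \<noteq> 0" by auto
    then have deg: "degree (slice P z) = ?n" by (rule degree_slice)
    show ?case
    proof (rule ccontr)
      assume "\<not> ?case"
      then have "norm (lead_coeff (slice P z)) * \<eta> ^ degree (slice P z) \<le> norm (poly (slice P z) w0)"
        using assms by (intro norm_poly_ge) (auto simp: dist_commute not_less)
      then show False using elim deg by simp
    qed
  qed
qed

section \<open>The unramified part of the algebraic curve as a covering space\<close>

definition algebraic_curve :: "complex poly poly \<Rightarrow> (complex \<times> complex) set" where
  "algebraic_curve P = {(z, w). z \<notin> critical_points P \<and> bi_poly P z w = 0}"

text \<open>The leading coefficient survives at z, so the slice keeps its degree; having no root in
  common with its derivative, it splits into distinct linear factors.\<close>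

lemma roots_card_noncritical:
  assumes "z \<notin> critical_points P"
  shows "finite {w. bi_poly P z w = 0}" "card {w. bi_poly P z w = 0} = degree P"
proof -
  have lc: "poly (lead_coeff P) z \<noteq> 0" using assms by (simp add: critical_points_def)
  then have deg: "degree (slice P z) = degree P" by (rule degree_slice)
  have nz: "slice P z \<noteq> 0"
    using lc by (metis coeff_0 coeff_slice)
  show fin: "finite {w. bi_poly P z w = 0}"
    using poly_roots_finite[OF nz] by simp
  have "rsquarefree (slice P z)"
    using assms by (auto simp: rsquarefree_roots pderiv_slice critical_points_def)
  from arg_cong[OF complex_poly_decompose_rsquarefree[OF this], of degree]
  have "degree (slice P z) = degree (\<Prod>w | bi_poly P z w = 0. [:- w, 1:])"
    using lc deg by simp
  also have "\<dots> = card {w. bi_poly P z w = 0}"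
    by (subst degree_prod_sum_eq) auto
  finally show "card {w. bi_poly P z w = 0} = degree P" using deg by simp
qed

lemma separated_roots:
  fixes W :: "'a::metric_space set"
  assumes "finite W"
  obtains \<delta> where "\<delta> > 0" "\<And>v w. v \<in> W \<Longrightarrow> w \<in> W \<Longrightarrow> v \<noteq> w \<Longrightarrow> ball v \<delta> \<inter> ball w \<delta> = {}"
proof -
  let ?D = "(\<lambda>(v, w). dist v w) ` {(v, w). v \<in> W \<and> w \<in> W \<and> v \<noteq> w}"
  have fin: "finite ?D"
    by (rule finite_imageI, rule finite_subset[of _ "W \<times> W"]) (use assms in auto)
  obtain d where d: "d > 0" "\<And>x. x \<in> ?D \<Longrightarrow> d \<le> x"
  proof (cases "?D = {}")
    case False
    with fin show ?thesis by (intro that[of "Min ?D"]) (auto simp: Min_gr_iff)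
  qed (use that[of 1] in auto)
  show ?thesis
  proof (rule that[of "d / 2"])
    fix v w assume "v \<in> W" "w \<in> W" "v \<noteq> w"
    then have "d \<le> dist v w" using d(2) by force
    then show "ball v (d / 2) \<inter> ball w (d / 2) = {}"
      by (auto simp: disjoint_iff) (smt (verit) dist_triangle2 field_sum_of_halves)
  qed (use d in auto)
qed

text \<open>A counting argument: over z near z0 each of the \<open>degree P\<close> disjoint balls
  about the roots over z0 contains a root, and there are exactly \<open>degree P\<close> roots over
  z. Hence each ball contains one root and none lies outside the balls.\<close>

lemma local_sheets:
  assumes "z0 \<notin> critical_points P" and fin: "finite (critical_points P)"
  obtains r \<delta> where "r > 0" "ball z0 r \<inter> critical_points P = {}"
    "pairwise (\<lambda>v w. ball v \<delta> \<inter> ball w \<delta> = {}) {w. bi_poly P z0 w = 0}"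
    "\<And>z v. z \<in> ball z0 r \<Longrightarrow> bi_poly P z0 v = 0 \<Longrightarrow> \<exists>!w. w \<in> ball v \<delta> \<and> bi_poly P z w = 0"
    "\<And>z w. z \<in> ball z0 r \<Longrightarrow> bi_poly P z w = 0 \<Longrightarrow> \<exists>v. bi_poly P z0 v = 0 \<and> w \<in> ball v \<delta>"
proof -
  let ?W = "{w. bi_poly P z0 w = 0}"
  note W = roots_card_noncritical[OF assms(1)]
  obtain \<delta> where \<delta>: "\<delta> > 0" and disj: "\<And>v w. v \<in> ?W \<Longrightarrow> w \<in> ?W \<Longrightarrow> v \<noteq> w \<Longrightarrow> ball v \<delta> \<inter> ball w \<delta> = {}"
    using separated_roots[OF W(1)] by metis
  have lc: "poly (lead_coeff P) z0 \<noteq> 0" using assms by (simp add: critical_points_def)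
  have "open (- critical_points P)" using fin by (simp add: finite_imp_closed open_Compl)
  then have "\<forall>\<^sub>F z in nhds z0. z \<in> - critical_points P"
    using assms by (intro eventually_nhds_in_open) auto
  moreover have "\<forall>\<^sub>F z in nhds z0. \<forall>v\<in>?W. \<exists>w\<in>ball v \<delta>. bi_poly P z w = 0"
    using W(1) by (intro eventually_ball_finite ballI eventually_root_near lc \<delta>) auto
  ultimately have "\<forall>\<^sub>F z in nhds z0. z \<notin> critical_points P \<and> (\<forall>v\<in>?W. \<exists>w\<in>ball v \<delta>. bi_poly P z w = 0)"
    by eventually_elim auto
  then obtain r where r: "r > 0" "\<And>z. z \<in> ball z0 r \<Longrightarrow> z \<notin> critical_points P"
      "\<And>z v. z \<in> ball z0 r \<Longrightarrow> bi_poly P z0 v = 0 \<Longrightarrow> \<exists>w\<in>ball v \<delta>. bi_poly P z w = 0"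
    unfolding eventually_nhds_metric by (auto simp: dist_commute)
  have sheets: "(\<forall>v\<in>?W. \<exists>!w. w \<in> ball v \<delta> \<and> bi_poly P z w = 0) \<and>
      (\<forall>w. bi_poly P z w = 0 \<longrightarrow> (\<exists>v\<in>?W. w \<in> ball v \<delta>))" if z: "z \<in> ball z0 r" for z
  proof -
    let ?Z = "{w. bi_poly P z w = 0}"
    note Z = roots_card_noncritical[OF r(2)[OF z]]
    have "\<forall>v\<in>?W. \<exists>w. w \<in> ball v \<delta> \<and> bi_poly P z w = 0" using r(3)[OF z] by blast
    then obtain f where f: "\<And>v. v \<in> ?W \<Longrightarrow> f v \<in> ball v \<delta> \<and> bi_poly P z (f v) = 0"
      using bchoice[of ?W "\<lambda>v w. w \<in> ball v \<delta> \<and> bi_poly P z w = 0"] by blast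
    have inj: "inj_on f ?W"
    proof (rule inj_onI)
      fix v w assume "v \<in> ?W" "w \<in> ?W" "f v = f w"
      with f[of v] f[of w] disj[of v w] show "v = w" by (metis IntI empty_iff)
    qed
    then have "f ` ?W = ?Z"
      using f Z W by (intro card_subset_eq) (auto simp: card_image)
    then have *: "\<exists>v\<in>?W. w = f v" if "bi_poly P z w = 0" for w using that by blast
    have uniq: "w = f v" if vw: "v \<in> ?W" "w \<in> ball v \<delta>" "bi_poly P z w = 0" for v w
    proof -
      obtain v' where v': "v' \<in> ?W" "w = f v'" using *[OF vw(3)] by blast
      with f[of v'] vw disj[of v v'] show ?thesis by blast
    qed
    show ?thesis
    proof (intro conjI ballI allI impI)
      fix v assume "v \<in> ?W"
      with f[of v] uniq[of v] show "\<exists>!w. w \<in> ball v \<delta> \<and> bi_poly P z w = 0" by blast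
    next
      fix w assume "bi_poly P z w = 0"
      with f * show "\<exists>v\<in>?W. w \<in> ball v \<delta>" by blast
    qed
  qed
  show ?thesis
    by (rule that[of r \<delta>]) (use r sheets disj in \<open>auto simp: pairwise_def\<close>)
qed

text \<open>Over a small disc the sheets are the graphs of \<open>root v\<close>, one for each root
  v over the centre. Positive degree makes the fibres nonempty, so the projection is onto.\<close>

lemma covering_space_algebraic_curve:
  assumes fin: "finite (critical_points P)" and "degree P > 0"
  shows "covering_space (algebraic_curve P) fst (- critical_points P)"
proof (rule covering_spaceI)
  show "fst ` algebraic_curve P = - critical_points P"
  proof -
    have "\<exists>w. bi_poly P z w = 0" if "z \<notin> critical_points P" for z
    proof -
      have "card {w. bi_poly P z w = 0} > 0" using roots_card_noncritical(2)[OF that] assms(2) by simp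
      then have "{w. bi_poly P z w = 0} \<noteq> {}" by (intro notI) simp
      then show ?thesis by blast
    qed
    then show ?thesis by (auto simp: algebraic_curve_def image_iff)
  qed
next
  fix z0 assume z0: "z0 \<in> - critical_points P"
  let ?X = "algebraic_curve P"
  obtain r \<delta> where r: "r > 0" "ball z0 r \<inter> critical_points P = {}"
    and disj: "pairwise (\<lambda>v w. ball v \<delta> \<inter> ball w \<delta> = {}) {w. bi_poly P z0 w = 0}"
    and ex1: "\<And>z v. z \<in> ball z0 r \<Longrightarrow> bi_poly P z0 v = 0 \<Longrightarrow> \<exists>!w. w \<in> ball v \<delta> \<and> bi_poly P z w = 0"
    and all: "\<And>z w. z \<in> ball z0 r \<Longrightarrow> bi_poly P z w = 0 \<Longrightarrow> \<exists>v. bi_poly P z0 v = 0 \<and> w \<in> ball v \<delta>"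
    by (rule local_sheets[OF ComplD[OF z0] fin]) (rule that)
  define sheet where "sheet v = ?X \<inter> (ball z0 r \<times> ball v \<delta>)" for v
  define root where "root v z = (THE w. w \<in> ball v \<delta> \<and> bi_poly P z w = 0)" for v z
  have root: "root v z \<in> ball v \<delta>" "bi_poly P z (root v z) = 0"
    if "bi_poly P z0 v = 0" "z \<in> ball z0 r" for v z
    using theI'[OF ex1[OF that(2,1)]] by (auto simp: root_def)
  have root_eq: "w = root v z"
    if "bi_poly P z0 v = 0" "z \<in> ball z0 r" "w \<in> ball v \<delta>" "bi_poly P z w = 0" for v w z
    using ex1[OF that(2,1)] root[OF that(1,2)] that(3,4) by blast
  have cont: "continuous_on (ball z0 r) (root v)" if v: "bi_poly P z0 v = 0" for v
    unfolding continuous_on_def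
  proof (intro ballI tendstoI)
    fix z e assume z: "z \<in> ball z0 r" and "e > (0::real)"
    \<comment> \<open>With \<eta> so small that the ball about \<open>root v z\<close> stays in
      \<open>ball v \<delta>\<close>, the root found nearby is the one that \<open>root v\<close>
      selects. Existence near a root and uniqueness in \<open>ball v \<delta>\<close> together give
      continuity.\<close>
    have "open (ball v \<delta> \<inter> ball (root v z) e)" "root v z \<in> ball v \<delta> \<inter> ball (root v z) e"
      using root[OF v z] \<open>e > 0\<close> by auto
    then obtain \<eta> where \<eta>: "\<eta> > 0" "ball (root v z) \<eta> \<subseteq> ball v \<delta> \<inter> ball (root v z) e"
      using openE by blast
    have "poly (lead_coeff P) z \<noteq> 0" using z r by (auto simp: critical_points_def)
    from eventually_root_near[OF this root(2)[OF v z] \<eta>(1)]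
    have "\<forall>\<^sub>F y in at z within ball z0 r. \<exists>w\<in>ball (root v z) \<eta>. bi_poly P y w = 0"
      by (rule filter_leD[OF at_within_le_nhds])
    moreover have "\<forall>\<^sub>F y in at z within ball z0 r. y \<in> ball z0 r"
      by (simp add: eventually_at_filter)
    ultimately show "\<forall>\<^sub>F y in at z within ball z0 r. dist (root v y) (root v z) < e"
    proof eventually_elim
      case (elim y)
      then obtain w where "w \<in> ball (root v z) \<eta>" "bi_poly P y w = 0" by blast
      with \<eta> root_eq[OF v elim(2)] have "root v y \<in> ball (root v z) e" by blast
      then show ?case by (simp add: dist_commute)
    qed
  qed
  have homeo: "homeomorphism (sheet v) (ball z0 r) fst (\<lambda>z. (z, root v z))" if v: "bi_poly P z0 v = 0" for v
  proof (rule homeomorphismI)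
    show "continuous_on (ball z0 r) (\<lambda>z. (z, root v z))"
      by (intro continuous_intros cont[OF v])
    show "continuous_on (sheet v) fst" by (intro continuous_intros)
    have "(z, root v z) \<in> sheet v" if "z \<in> ball z0 r" for z
      using root[OF v that] that r(2) unfolding sheet_def algebraic_curve_def by blast
    then show "(\<lambda>z. (z, root v z)) ` ball z0 r \<subseteq> sheet v" by blast
    show "fst ` sheet v \<subseteq> ball z0 r" by (auto simp: sheet_def)
    show "(fst x, root v (fst x)) = x" if "x \<in> sheet v" for x
      using that root_eq[OF v, of "fst x" "snd x"]
      by (cases x) (auto simp: sheet_def algebraic_curve_def)
  qed simp_all
  show "\<exists>T. z0 \<in> T \<and> openin (top_of_set (- critical_points P)) T \<and>
      (\<exists>v. \<Union>v = ?X \<inter> fst -` T \<and> (\<forall>u\<in>v. openin (top_of_set ?X) u) \<and>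
        pairwise disjnt v \<and> (\<forall>u\<in>v. \<exists>q. homeomorphism u T fst q))"
  proof (intro exI[of _ "ball z0 r"] exI[of _ "sheet ` {w. bi_poly P z0 w = 0}"] conjI ballI)
    show "openin (top_of_set (- critical_points P)) (ball z0 r)"
      using r by (intro open_openin_trans) (auto intro: finite_imp_closed fin simp: open_Compl)
    show "\<Union> (sheet ` {w. bi_poly P z0 w = 0}) = ?X \<inter> fst -` ball z0 r"
      using all by (auto simp: sheet_def algebraic_curve_def)
    show "pairwise disjnt (sheet ` {w. bi_poly P z0 w = 0})"
    proof (intro pairwiseI)
      fix s t assume "s \<in> sheet ` {w. bi_poly P z0 w = 0}" "t \<in> sheet ` {w. bi_poly P z0 w = 0}" "s \<noteq> t"
      then obtain v w where vw: "bi_poly P z0 v = 0" "bi_poly P z0 w = 0" "s = sheet v" "t = sheet w" "v \<noteq> w"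
        by blast
      then have "ball v \<delta> \<inter> ball w \<delta> = {}" using disj by (simp add: pairwise_def)
      then show "disjnt s t" unfolding vw(3,4) sheet_def disjnt_def by blast
    qed
  next
    fix u assume "u \<in> sheet ` {w. bi_poly P z0 w = 0}"
    then obtain v where v: "bi_poly P z0 v = 0" "u = sheet v" by blast
    show "openin (top_of_set ?X) u"
      unfolding v(2) sheet_def by (intro openin_open_Int open_Times open_ball)
    show "\<exists>q. homeomorphism u (ball z0 r) fst q"
      using homeo[OF v(1)] v(2) by blast
  qed (use r in auto)
qed (intro continuous_intros)

section \<open>Holomorphic branches of algebraic functions\<close>

text \<open>Implicit differentiation done by algebra: dividing P(z, .) by the root w leaves a
  cofactor q with q(w) equal to the derivative of P in w, which is nonzero off the critical points.
  The difference quotient of \<phi> is then a quotient with a limit.\<close>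

lemma algebraic_function_holomorphic:
  assumes "open U" "U \<inter> critical_points P = {}" "continuous_on U \<phi>"
    and zero: "\<And>z. z \<in> U \<Longrightarrow> bi_poly P z (\<phi> z) = 0"
  shows "\<phi> holomorphic_on U"
proof -
  have "\<phi> field_differentiable at z" if z: "z \<in> U" for z
  proof -
    define w where "w = \<phi> z"
    define q where "q = synthetic_div (slice P z) w"
    \<comment> \<open>\<open>R y\<close> is the difference quotient of P in its first variable, with
      the second variable held at \<open>\<phi> y\<close>. It tends to the partial derivative in z
      at (z, w).\<close>
    define R where "R y = (\<Sum>i\<le>degree P. (poly (coeff P i) y - poly (coeff P i) z) / (y - z) * \<phi> y ^ i)" for y
    have root: "bi_poly P z w = 0" using zero[OF z] by (simp add: w_def)
    have div: "slice P z = [:-w, 1:] * q"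
      using synthetic_div_correct'[of w "slice P z"] root by (simp add: q_def)
    have "poly (pderiv (slice P z)) w = poly q w"
      unfolding div by (simp add: pderiv_mult pderiv_pCons pderiv_diff pderiv_smult)
    then have qw: "poly q w \<noteq> 0"
      using assms(2) z root by (auto simp: pderiv_slice critical_points_def)
    have \<phi>: "(\<phi> \<longlongrightarrow> w) (at z)"
      using assms(1,3) z unfolding w_def by (metis continuous_on_eq_continuous_at isContD)
    have R: "(R \<longlongrightarrow> (\<Sum>i\<le>degree P. poly (pderiv (coeff P i)) z * w ^ i)) (at z)"
      unfolding R_def
      using poly_DERIV[unfolded has_field_derivative_iff]
      by (intro tendsto_intros \<phi>) auto
    have q: "((\<lambda>y. poly q (\<phi> y)) \<longlongrightarrow> poly q w) (at z)"
      by (intro tendsto_poly \<phi>)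
    have "((\<lambda>y. - R y / poly q (\<phi> y)) \<longlongrightarrow>
        - (\<Sum>i\<le>degree P. poly (pderiv (coeff P i)) z * w ^ i) / poly q w) (at z)"
      by (intro tendsto_intros R q qw)
    moreover have "\<forall>\<^sub>F y in at z. (\<phi> y - \<phi> z) / (y - z) = - R y / poly q (\<phi> y)"
    proof -
      have "\<forall>\<^sub>F y in at z. poly q (\<phi> y) \<noteq> 0"
        using q qw by (rule tendsto_imp_eventually_ne)
      moreover have "\<forall>\<^sub>F y in at z. y \<in> U - {z}"
        using assms(1) z by (rule eventually_at_in_open)
      ultimately show ?thesis
      proof eventually_elim
        case (elim y)
        then have y: "y - z \<noteq> 0" "bi_poly P y (\<phi> y) = 0" using zero by auto
        have "(y - z) * R y = (\<Sum>i\<le>degree P. (poly (coeff P i) y - poly (coeff P i) z) * \<phi> y ^ i)"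
          using y(1) by (simp add: R_def sum_distrib_left)
        also have "\<dots> = bi_poly P y (\<phi> y) - bi_poly P z (\<phi> y)"
          by (simp add: bi_poly_altdef sum_subtractf left_diff_distrib)
        also have "\<dots> = - (\<phi> y - w) * poly q (\<phi> y)"
          using y(2) arg_cong[OF div, of "\<lambda>p. poly p (\<phi> y)"] by (simp add: algebra_simps)
        finally show ?case
          using y(1) elim(1) by (simp add: field_simps w_def)
      qed
    qed
    ultimately have "((\<lambda>y. (\<phi> y - \<phi> z) / (y - z)) \<longlongrightarrow>
        - (\<Sum>i\<le>degree P. poly (pderiv (coeff P i)) z * w ^ i) / poly q w) (at z)"
      by (simp add: tendsto_cong)
    then show ?thesis
      unfolding field_differentiable_def has_field_derivative_iff by blast
  qed
  then show ?thesis using holomorphic_on_def field_differentiable_at_within by blast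
qed

text \<open>Uniqueness of lifts to the covering. The base map f is kept general so that the same
  fact serves parameter intervals of a path and discs in the plane.\<close>

lemma algebraic_function_unique:
  fixes f g1 g2 :: "'a::topological_space \<Rightarrow> complex"
  assumes P: "finite (critical_points P)" "degree P > 0"
    and S: "connected S" "a \<in> S" "x \<in> S"
    and cont: "continuous_on S f" "continuous_on S g1" "continuous_on S g2"
    and f: "\<And>y. y \<in> S \<Longrightarrow> f y \<notin> critical_points P"
    and g1: "\<And>y. y \<in> S \<Longrightarrow> bi_poly P (f y) (g1 y) = 0"
    and g2: "\<And>y. y \<in> S \<Longrightarrow> bi_poly P (f y) (g2 y) = 0"
    and "g1 a = g2 a"
  shows "g1 x = g2 x"
proof -
  have "(\<lambda>y. (f y, g1 y)) x = (\<lambda>y. (f y, g2 y)) x"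
    by (rule covering_space_lift_unique[OF covering_space_algebraic_curve[OF P], of _ a _ S f])
       (use assms in \<open>auto simp: algebraic_curve_def intro!: continuous_intros\<close>)
  then show ?thesis by simp
qed

text \<open>The covering projection has a local inverse through (z0, w0); its second component is
  continuous and satisfies the equation, hence is holomorphic.\<close>

lemma local_branch:
  assumes P: "finite (critical_points P)" "degree P > 0" and "z0 \<notin> critical_points P" "bi_poly P z0 w0 = 0"
  obtains r \<phi> where "r > 0" "ball z0 r \<inter> critical_points P = {}" "\<phi> holomorphic_on ball z0 r"
    "\<phi> z0 = w0" "\<And>z. z \<in> ball z0 r \<Longrightarrow> bi_poly P z (\<phi> z) = 0"
proof -
  have "(z0, w0) \<in> algebraic_curve P" using assms by (simp add: algebraic_curve_def)
  from covering_space_local_homeomorphism[OF covering_space_algebraic_curve[OF P] this]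
  obtain T u q where T: "(z0, w0) \<in> T" "openin (top_of_set (algebraic_curve P)) T" "z0 \<in> u"
    "openin (top_of_set (- critical_points P)) u" "homeomorphism T u fst q" by auto
  have "open (- critical_points P)" using P by (simp add: finite_imp_closed open_Compl)
  then have "open u" using T(4) openin_open_trans by blast
  then obtain r where r: "r > 0" "ball z0 r \<subseteq> u" using T(3) openE by blast
  have crit: "ball z0 r \<inter> critical_points P = {}"
    using r(2) openin_imp_subset[OF T(4)] by blast
  have q: "q z \<in> algebraic_curve P" "fst (q z) = z" if "z \<in> ball z0 r" for z
  proof -
    have "z \<in> u" using that r(2) by blast
    then show "fst (q z) = z" by (rule homeomorphism_apply2[OF T(5)])
    from \<open>z \<in> u\<close> have "q z \<in> T" unfolding homeomorphism_image2[OF T(5), symmetric] by (rule imageI)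
    then show "q z \<in> algebraic_curve P" using openin_imp_subset[OF T(2)] by (rule subsetD[rotated])
  qed
  have zero: "bi_poly P z (snd (q z)) = 0" if "z \<in> ball z0 r" for z
    using q[OF that] by (auto simp: algebraic_curve_def split: prod.splits)
  have cont: "continuous_on (ball z0 r) (\<lambda>z. snd (q z))"
    by (intro continuous_on_snd continuous_on_subset[OF homeomorphism_cont2[OF T(5)] r(2)])
  show ?thesis
  proof (rule that[OF r(1) crit algebraic_function_holomorphic[OF _ crit cont zero]])
    show "snd (q z0) = w0"
      using homeomorphism_apply1[OF T(5) T(1)] by simp
  qed (use zero in auto)
qed

text \<open>This converts a topological lift into analytic continuation: at each time t the local
  branch with value h t is taken, and continuity of h makes neighbouring branches
  compatible.\<close>

lemma lifted_path_germ_family: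
  assumes P: "finite (critical_points P)" "degree P > 0"
    and "path q" "path h" and crit: "path_image q \<inter> critical_points P = {}"
    and zero: "\<And>t. t \<in> {0..1} \<Longrightarrow> bi_poly P (q t) (h t) = 0"
  obtains \<Phi> where "germ_family q 0 1 \<Phi>"
    "\<And>t. t \<in> {0..1} \<Longrightarrow> \<Phi> t analytic_on {q t}" "\<And>t. t \<in> {0..1} \<Longrightarrow> \<Phi> t (q t) = h t"
    "\<And>t. t \<in> {0..1} \<Longrightarrow> \<forall>\<^sub>F z in nhds (q t). bi_poly P z (\<Phi> t z) = 0"
proof -
  have nc: "q t \<notin> critical_points P" if "t \<in> {0..1}" for t
    using crit that unfolding path_image_def by blast
  have "\<forall>t\<in>{0..1}. \<exists>x. fst x > 0 \<and> ball (q t) (fst x) \<inter> critical_points P = {} \<and>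
      snd x holomorphic_on ball (q t) (fst x) \<and> snd x (q t) = h t \<and>
      (\<forall>z\<in>ball (q t) (fst x). bi_poly P z (snd x z) = 0)"
  proof
    fix t :: real assume t: "t \<in> {0..1}"
    obtain r \<phi> where "r > 0" "ball (q t) r \<inter> critical_points P = {}" "\<phi> holomorphic_on ball (q t) r"
      "\<phi> (q t) = h t" "\<And>z. z \<in> ball (q t) r \<Longrightarrow> bi_poly P z (\<phi> z) = 0"
      by (rule local_branch[OF P nc[OF t] zero[OF t]]) (rule that)
    then show "\<exists>x. fst x > 0 \<and> ball (q t) (fst x) \<inter> critical_points P = {} \<and>
      snd x holomorphic_on ball (q t) (fst x) \<and> snd x (q t) = h t \<and>
      (\<forall>z\<in>ball (q t) (fst x). bi_poly P z (snd x z) = 0)"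
      by (intro exI[of _ "(r, \<phi>)"]) simp
  qed
  from bchoice[OF this] obtain b where b: "\<And>t. t \<in> {0..1} \<Longrightarrow> fst (b t) > 0 \<and>
      ball (q t) (fst (b t)) \<inter> critical_points P = {} \<and>
      snd (b t) holomorphic_on ball (q t) (fst (b t)) \<and> snd (b t) (q t) = h t \<and>
      (\<forall>z\<in>ball (q t) (fst (b t)). bi_poly P z (snd (b t) z) = 0)" by blast
  define r where "r t = fst (b t)" for t
  define \<Phi> where "\<Phi> t = snd (b t)" for t
  have r: "r t > 0" "ball (q t) (r t) \<inter> critical_points P = {}" "\<Phi> t holomorphic_on ball (q t) (r t)"
      "\<Phi> t (q t) = h t" "\<And>z. z \<in> ball (q t) (r t) \<Longrightarrow> bi_poly P z (\<Phi> t z) = 0"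
    if "t \<in> {0..1}" for t
    using b[OF that] unfolding r_def \<Phi>_def by blast+
  have an: "\<Phi> t analytic_on {q t}" if "t \<in> {0..1}" for t
    using r[OF that] by (meson analytic_at centre_in_ball open_ball)
  have qc: "continuous_on {0..1} q" and hc: "continuous_on {0..1} h"
    using assms by (auto simp: path_def)
  have "germ_family q 0 1 \<Phi>"
  proof (rule germ_familyI)
    fix t :: real assume t: "t \<in> {0..1}"
    show "\<Phi> t meromorphic_on {q t}" using an[OF t] by (rule analytic_on_imp_meromorphic_on)
    obtain \<delta> where \<delta>: "\<delta> > 0" "\<And>s. s \<in> {0..1} \<Longrightarrow> dist s t < \<delta> \<Longrightarrow> dist (q s) (q t) < r t"
      using qc t r(1)[OF t] unfolding continuous_on_iff by metis
    have "\<forall>\<^sub>F z in at (q s). \<Phi> s z = \<Phi> t z" if s: "s \<in> {0..1}" "dist s t < \<delta>" for s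
    proof -
      let ?J = "{0..1} \<inter> ball t \<delta>"
      have qJ: "q y \<in> ball (q t) (r t)" if "y \<in> ?J" for y
        using \<delta>(2)[of y] that by (auto simp: dist_commute)
      \<comment> \<open>On the parameter interval about t, both h and the branch
        \<open>\<Phi> t\<close> evaluated along q lift the same path and agree at t.\<close>
      have "h s = \<Phi> t (q s)"
      proof (rule algebraic_function_unique[OF P, of ?J t s q h "\<lambda>y. \<Phi> t (q y)"])
        show "connected ?J" by (intro convex_connected convex_Int) auto
        show "continuous_on ?J q" "continuous_on ?J h"
          using qc hc by (auto intro: continuous_on_subset)
        show "continuous_on ?J (\<lambda>y. \<Phi> t (q y))"
          by (rule continuous_on_compose2[OF holomorphic_on_imp_continuous_on[OF r(3)[OF t]]])
             (use qc qJ in \<open>auto intro: continuous_on_subset\<close>)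
        show "q y \<notin> critical_points P" if "y \<in> ?J" for y using nc that by blast
        show "bi_poly P (q y) (h y) = 0" if "y \<in> ?J" for y using zero that by blast
        show "bi_poly P (q y) (\<Phi> t (q y)) = 0" if "y \<in> ?J" for y using r(5)[OF t] qJ that by blast
        show "h t = \<Phi> t (q t)" using r(4)[OF t] by simp
      qed (use s t \<delta> in \<open>auto simp: dist_commute\<close>)
      then have eq: "\<Phi> s (q s) = \<Phi> t (q s)" using r(4)[OF s(1)] by simp
      \<comment> \<open>The two discs meet in a convex set containing q s. The branches agree at q
        s, hence on the whole intersection.\<close>
      have "q s \<in> ball (q t) (r t) \<inter> ball (q s) (r s)"
        using \<delta>(2)[OF s] r(1)[OF s(1)] by (simp add: dist_commute)
      then have "\<forall>\<^sub>F z in nhds (q s). z \<in> ball (q t) (r t) \<inter> ball (q s) (r s)"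
        by (intro eventually_nhds_in_open) auto
      then have "\<forall>\<^sub>F z in nhds (q s). \<Phi> s z = \<Phi> t z"
      proof eventually_elim
        case (elim z)
        let ?B = "ball (q t) (r t) \<inter> ball (q s) (r s)"
        show ?case
        proof (rule algebraic_function_unique[OF P, of ?B "q s" z "\<lambda>z. z" "\<Phi> s" "\<Phi> t"])
          show "connected ?B" by (intro convex_connected convex_Int convex_ball)
          show "continuous_on ?B (\<Phi> s)" "continuous_on ?B (\<Phi> t)"
            using r(3)[OF s(1)] r(3)[OF t]
            by (auto dest!: holomorphic_on_imp_continuous_on intro: continuous_on_subset)
          show "y \<notin> critical_points P" if "y \<in> ?B" for y using r(2)[OF t] that by blast
          show "bi_poly P y (\<Phi> s y) = 0" if "y \<in> ?B" for y using r(5)[OF s(1)] that by blast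
          show "bi_poly P y (\<Phi> t y) = 0" if "y \<in> ?B" for y using r(5)[OF t] that by blast
        qed (use elim eq \<open>q s \<in> ?B\<close> in auto)
      qed
      then show ?thesis by (rule filter_leD[OF at_within_le_nhds])
    qed
    then show "\<exists>\<delta>>0. \<forall>s\<in>{0..1}. dist s t < \<delta> \<longrightarrow> (\<forall>\<^sub>F z in at (q s). \<Phi> s z = \<Phi> t z)"
      using \<delta>(1) by blast
  qed
  moreover have "\<forall>\<^sub>F z in nhds (q t). bi_poly P z (\<Phi> t z) = 0" if "t \<in> {0..1}" for t
  proof -
    have "\<forall>\<^sub>F z in nhds (q t). z \<in> ball (q t) (r t)"
      using r(1)[OF that] by (intro eventually_nhds_in_open) auto
    then show ?thesis by eventually_elim (use r(5)[OF that] in auto)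
  qed
  ultimately show ?thesis using that[of \<Phi>] an r(4) by blast
qed

section \<open>Single-valued roots across an isolated critical point\<close>

text \<open>With \<open>c\<close> the leading coefficient and \<open>u = c w\<close>, the equation multiplied by \<open>c\<^sup>n\<^sup>-\<^sup>1\<close> is monic in \<open>u\<close>.\<close>

lemma root_bound:
  fixes P :: "complex poly poly"
  assumes "bi_poly P z w = 0" "degree P > 0"
  defines "c \<equiv> poly (lead_coeff P) z"
  shows "norm (c * w) \<le> max 1 (\<Sum>i<degree P. norm (poly (coeff P i) z) * norm c ^ (degree P - 1 - i))"
proof (cases "norm (c * w) \<le> 1")
  case False
  let ?n = "degree P" and ?u = "norm (c * w)"
  have "0 = c ^ (?n - 1) * (\<Sum>i\<le>?n. poly (coeff P i) z * w ^ i)"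
    using assms(1) by (simp add: bi_poly_altdef)
  also have "\<dots> = c ^ (?n - 1) * (\<Sum>i<?n. poly (coeff P i) z * w ^ i) + c ^ (?n - 1) * (c * w ^ ?n)"
    by (simp add: c_def lessThan_Suc_atMost[symmetric] distrib_left)
  also have "c ^ (?n - 1) * (c * w ^ ?n) = (c * w) ^ ?n"
    using assms(2) by (simp add: power_mult_distrib power_eq_if[of c ?n] mult_ac)
  also have "c ^ (?n - 1) * (\<Sum>i<?n. poly (coeff P i) z * w ^ i) =
      (\<Sum>i<?n. poly (coeff P i) z * c ^ (?n - 1 - i) * (c * w) ^ i)"
  proof (subst sum_distrib_left, rule sum.cong)
    fix i assume "i \<in> {..<?n}"
    then have "c ^ (?n - 1) = c ^ (?n - 1 - i) * c ^ i" by (simp flip: power_add)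
    then show "c ^ (?n - 1) * (poly (coeff P i) z * w ^ i) = poly (coeff P i) z * c ^ (?n - 1 - i) * (c * w) ^ i"
      by (simp add: power_mult_distrib mult_ac)
  qed auto
  finally have "(c * w) ^ ?n = - (\<Sum>i<?n. poly (coeff P i) z * c ^ (?n - 1 - i) * (c * w) ^ i)"
    by (simp add: eq_neg_iff_add_eq_0 add.commute)
  then have "?u ^ ?n = norm (\<Sum>i<?n. poly (coeff P i) z * c ^ (?n - 1 - i) * (c * w) ^ i)"
    by (simp only: norm_power[symmetric] norm_minus_cancel)
  \<comment> \<open>Since |c w| exceeds 1, every lower power is at most the power n - 1, which can
    afterwards be cancelled.\<close>
  also have "\<dots> \<le> (\<Sum>i<?n. norm (poly (coeff P i) z) * norm c ^ (?n - 1 - i) * ?u ^ (?n - 1))"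
  proof (intro sum_norm_le)
    fix i assume "i \<in> {..<?n}"
    then have "?u ^ i \<le> ?u ^ (?n - 1)" using False by (intro power_increasing) auto
    then show "norm (poly (coeff P i) z * c ^ (?n - 1 - i) * (c * w) ^ i) \<le>
        norm (poly (coeff P i) z) * norm c ^ (?n - 1 - i) * ?u ^ (?n - 1)"
      unfolding norm_mult[of _ "(c * w) ^ i"] norm_power norm_mult[of "poly _ _"]
      by (intro mult_left_mono) auto
  qed
  finally have "?u * ?u ^ (?n - 1) \<le>
      (\<Sum>i<?n. norm (poly (coeff P i) z) * norm c ^ (?n - 1 - i)) * ?u ^ (?n - 1)"
    using assms(2) by (simp add: sum_distrib_right power_eq_if[of ?u ?n])
  moreover have "?u ^ (?n - 1) > 0" using False by (intro zero_less_power) linarith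
  ultimately show ?thesis by (simp add: mult_le_cancel_right)
qed simp

text \<open>The root may have a pole where the leading coefficient vanishes; its product with that
  coefficient is bounded near z0, so Riemann's removable singularity theorem applies to the
  product.\<close>

lemma algebraic_function_extend:
  assumes "r > 0" "degree P > 0" "\<phi> holomorphic_on ball z0 r - {z0}"
    and "\<And>z. z \<in> ball z0 r - {z0} \<Longrightarrow> bi_poly P z (\<phi> z) = 0"
  obtains g where "g holomorphic_on ball z0 r"
    "\<And>z. z \<in> ball z0 r - {z0} \<Longrightarrow> g z = poly (lead_coeff P) z * \<phi> z"
proof -
  let ?b = "\<lambda>z. \<Sum>i<degree P. norm (poly (coeff P i) z) * norm (poly (lead_coeff P) z) ^ (degree P - 1 - i)"
  have "(?b \<longlongrightarrow> ?b z0) (at z0)" by (intro tendsto_intros tendsto_poly)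
  then have "\<forall>\<^sub>F z in at z0. ?b z < ?b z0 + 1" by (rule order_tendstoD) simp
  moreover have "\<forall>\<^sub>F z in at z0. z \<in> ball z0 r - {z0}"
    using assms(1) by (intro eventually_at_in_open) auto
  ultimately have "\<forall>\<^sub>F z in at z0. norm (poly (lead_coeff P) z * \<phi> z) \<le> max 1 (?b z0 + 1)"
  proof eventually_elim
    case (elim z)
    with root_bound[OF assms(4)[OF elim(2)] assms(2)] show ?case by linarith
  qed
  moreover have "(\<lambda>z. poly (lead_coeff P) z * \<phi> z) holomorphic_on ball z0 r - {z0}"
    by (intro holomorphic_intros assms)
  ultimately show ?thesis
    using holomorphic_on_extend_bounded[of "\<lambda>z. poly (lead_coeff P) z * \<phi> z" "ball z0 r" z0] assms(1) that
    by auto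
qed

text \<open>Dividing the extended product by the leading coefficient recovers \<phi>, with at worst
  a pole. Colliding roots do no harm, because \<phi> is assumed single-valued on the punctured
  disc.\<close>

lemma algebraic_function_meromorphic:
  assumes "r > 0" "degree P > 0" "\<phi> holomorphic_on ball z0 r - {z0}"
    and "\<And>z. z \<in> ball z0 r - {z0} \<Longrightarrow> bi_poly P z (\<phi> z) = 0"
  shows "\<phi> meromorphic_on {z0}"
    and "poly (lead_coeff P) z0 \<noteq> 0 \<Longrightarrow> \<exists>\<psi>. \<psi> analytic_on {z0} \<and> (\<forall>\<^sub>F z in at z0. \<psi> z = \<phi> z)"
proof -
  obtain g where g: "g holomorphic_on ball z0 r"
    "\<And>z. z \<in> ball z0 r - {z0} \<Longrightarrow> g z = poly (lead_coeff P) z * \<phi> z"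
    by (rule algebraic_function_extend[OF assms]) (assumption | rule that)+
  have an: "g analytic_on {z0}" using g(1) assms(1) by (meson analytic_at centre_in_ball open_ball)
  have "lead_coeff P \<noteq> 0" using assms(2) by auto
  then have "finite {z. poly (lead_coeff P) z = 0}" by (rule poly_roots_finite)
  then have "\<forall>\<^sub>F z in at z0. poly (lead_coeff P) z \<noteq> 0"
    using islimpt_finite[of "{z. poly (lead_coeff P) z = 0}" z0]
    by (auto simp: islimpt_conv_frequently_at frequently_def)
  moreover have "\<forall>\<^sub>F z in at z0. z \<in> ball z0 r - {z0}"
    using assms(1) by (intro eventually_at_in_open) auto
  ultimately have eq: "\<forall>\<^sub>F z in at z0. g z / poly (lead_coeff P) z = \<phi> z"
    by eventually_elim (simp add: g(2))
  have "(\<lambda>z. g z / poly (lead_coeff P) z) meromorphic_on {z0}"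
    by (intro meromorphic_intros meromorphic_on_poly analytic_on_imp_meromorphic_on an)
  then show "\<phi> meromorphic_on {z0}"
    using meromorphic_on_cong[of "{z0}" "\<lambda>z. g z / poly (lead_coeff P) z" \<phi>] eq by auto
  show "\<exists>\<psi>. \<psi> analytic_on {z0} \<and> (\<forall>\<^sub>F z in at z0. \<psi> z = \<phi> z)" if "poly (lead_coeff P) z0 \<noteq> 0"
  proof (intro exI conjI)
    show "(\<lambda>z. g z / poly (lead_coeff P) z) analytic_on {z0}"
      using that by (intro analytic_intros an analytic_on_poly) auto
  qed (rule eq)
qed

text \<open>The leading coefficient is nonzero at z0, so the singularity is removable. Germs ignore
  the value at the centre, hence f is replaced by \<phi>, whose value is a root by passage to the
  limit.\<close>

lemma algebraic_germ_regular:
  assumes f: "f meromorphic_on {z0}" and z0: "z0 \<notin> critical_points P" and "degree P > 0"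
    and zero: "\<forall>\<^sub>F z in at z0. bi_poly P z (f z) = 0"
  obtains \<phi> where "\<phi> analytic_on {z0}" "\<forall>\<^sub>F z in at z0. \<phi> z = f z" "bi_poly P z0 (\<phi> z0) = 0"
proof -
  obtain r1 where r1: "r1 > 0" "f analytic_on ball z0 r1 - {z0}"
    using meromorphic_on_isolated_singularity[OF f] unfolding isolated_singularity_at_def by blast
  obtain r2 where r2: "r2 > 0" "\<And>z. z \<noteq> z0 \<Longrightarrow> dist z z0 < r2 \<Longrightarrow> bi_poly P z (f z) = 0"
    using zero unfolding eventually_at by blast
  have "f holomorphic_on ball z0 (min r1 r2) - {z0}"
    by (rule analytic_imp_holomorphic, rule analytic_on_subset[OF r1(2)]) auto
  moreover have "bi_poly P z (f z) = 0" if "z \<in> ball z0 (min r1 r2) - {z0}" for z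
    using r2(2)[of z] that by (auto simp: dist_commute)
  moreover have "poly (lead_coeff P) z0 \<noteq> 0" using z0 by (simp add: critical_points_def)
  ultimately obtain \<phi> where \<phi>: "\<phi> analytic_on {z0}" "\<forall>\<^sub>F z in at z0. \<phi> z = f z"
    using algebraic_function_meromorphic(2)[of "min r1 r2" P f z0] r1 r2 assms(3) by auto
  have "(\<phi> \<longlongrightarrow> \<phi> z0) (at z0)" using analytic_at_imp_isCont[OF \<phi>(1)] by (simp add: isCont_def)
  then have "((\<lambda>z. bi_poly P z (\<phi> z)) \<longlongrightarrow> bi_poly P z0 (\<phi> z0)) (at z0)"
    by (intro continuous_bi_poly tendsto_intros)
  moreover have ev: "\<forall>\<^sub>F z in at z0. bi_poly P z (\<phi> z) = 0"
    using \<phi>(2) zero by eventually_elim simp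
  ultimately have "((\<lambda>z. 0) \<longlongrightarrow> bi_poly P z0 (\<phi> z0)) (at z0)"
    using tendsto_cong[OF ev] by blast
  then have "bi_poly P z0 (\<phi> z0) = 0" by (simp add: tendsto_const_iff)
  with \<phi> that show ?thesis by blast
qed

section \<open>Continuation along paths avoiding the branch points\<close>

text \<open>These are the germs over k on all sheets, the same ones over which
  \<open>branch_points\<close> quantifies.\<close>

definition reachable ::
    "complex set \<Rightarrow> ('n::finite) matrix_fun \<Rightarrow> complex \<Rightarrow> 'n matrix_fun \<Rightarrow> bool" where
  "reachable S G k g \<longleftrightarrow> (\<exists>p. pathstart p \<in> S \<and> pathfinish p = k \<and> continues_along p G g)"

lemma reachable_extend:
  assumes "reachable S G (pathstart q) g" "continues_along q g h"
  shows "reachable S G (pathfinish q) h"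
proof -
  obtain p where "pathstart p \<in> S" "pathfinish p = pathstart q" "continues_along p G g"
    using assms(1) unfolding reachable_def by blast
  then show ?thesis
    using continues_along_join[OF _ assms(2), of p G] unfolding reachable_def
    by (intro exI[of _ "p +++ q"]) simp
qed

lemma reachable_meromorphic: "reachable S G k g \<Longrightarrow> meromorphic_matrix_on g {k}"
  unfolding reachable_def using continues_along_meromorphic(2) by blast

lemma reachable_cong: "reachable S G k g \<Longrightarrow> same_germ k g h \<Longrightarrow> reachable S G k h"
  unfolding reachable_def using continues_along_cong same_germ_refl by blast

text \<open>Permanence of an algebraic equation: substituting a germ family into P gives a germ
  family, so the identity principle applies. One polynomial per entry therefore serves all
  branches.\<close>

lemma continues_along_bi_poly_iff:
  fixes f g :: "('n::finite) matrix_fun"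
  assumes "continues_along p f g"
  shows "(\<forall>\<^sub>F z in at (pathstart p). bi_poly P z (f z $ i $ j) = 0) \<longleftrightarrow>
    (\<forall>\<^sub>F z in at (pathfinish p). bi_poly P z (g z $ i $ j) = 0)"
proof -
  obtain F where F: "path p" "matrix_germ_family p 0 1 F"
    "same_germ (pathstart p) (F 0) f" "same_germ (pathfinish p) (F 1) g"
    by (rule continues_alongE[OF assms])
  have cong: "(\<forall>\<^sub>F z in at k. bi_poly P z (u z $ i $ j) = 0) \<longleftrightarrow> (\<forall>\<^sub>F z in at k. bi_poly P z (v z $ i $ j) = 0)"
    if "same_germ k u v" for k and u v :: "'n matrix_fun"
    by (rule eventually_subst) (use that in \<open>auto simp: same_germ_def elim: eventually_mono\<close>)
  have "germ_family p 0 1 (\<lambda>t z. bi_poly P z (F t z $ i $ j))"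
    using germ_family_map[OF matrix_germ_familyD[OF F(2), of i j], of "bi_poly P"]
      germ_family_meromorphic[OF matrix_germ_familyD[OF F(2)]] meromorphic_on_bi_poly by blast
  from germ_family_zero_iff[OF this path_continuous[OF F(1)]] show ?thesis
    using cong[OF F(3)] cong[OF F(4)] by (simp add: pathstart_def pathfinish_def)
qed

lemma analytic_at_eventually:
  assumes "f analytic_on {z0}"
  shows "\<forall>\<^sub>F z in nhds z0. f analytic_on {z}"
proof -
  obtain T where T: "open T" "z0 \<in> T" "f holomorphic_on T" using assms analytic_at by blast
  then have "\<forall>\<^sub>F z in nhds z0. z \<in> T" by (intro eventually_nhds_in_open)
  then show ?thesis by eventually_elim (use T in \<open>auto simp: analytic_at\<close>)
qed

text \<open>Branches are chosen for all matrix entries simultaneously, since the monodromy is that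
  of the matrix germ.\<close>

lemma choice2: "\<forall>i j. \<exists>x. Q i j x \<Longrightarrow> \<exists>f. \<forall>i j. Q i j (f i j)"
  by metis

text \<open>Off the critical points two solutions are lifts to the covering, so on a disc they are
  determined by their value at the centre.\<close>

lemma algebraic_function_germ_unique:
  assumes P: "finite (critical_points P)" "degree P > 0" "z0 \<notin> critical_points P"
    and an: "\<phi> analytic_on {z0}" "\<psi> analytic_on {z0}"
    and zero: "\<forall>\<^sub>F z in nhds z0. bi_poly P z (\<phi> z) = 0" "\<forall>\<^sub>F z in nhds z0. bi_poly P z (\<psi> z) = 0"
    and eq: "\<phi> z0 = \<psi> z0"
  shows "\<forall>\<^sub>F z in nhds z0. \<phi> z = \<psi> z"
proof -
  have "open (- critical_points P)" using P by (simp add: finite_imp_closed open_Compl)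
  then have "\<forall>\<^sub>F z in nhds z0. z \<in> - critical_points P"
    using P by (intro eventually_nhds_in_open) auto
  moreover have "\<forall>\<^sub>F z in nhds z0. \<phi> analytic_on {z}" "\<forall>\<^sub>F z in nhds z0. \<psi> analytic_on {z}"
    by (intro analytic_at_eventually an)+
  ultimately have "\<forall>\<^sub>F z in nhds z0. z \<notin> critical_points P \<and> \<phi> analytic_on {z} \<and> \<psi> analytic_on {z} \<and>
      bi_poly P z (\<phi> z) = 0 \<and> bi_poly P z (\<psi> z) = 0"
    using zero by eventually_elim auto
  then obtain r where r: "r > 0" "\<And>z. z \<in> ball z0 r \<Longrightarrow> z \<notin> critical_points P \<and> \<phi> analytic_on {z} \<and>
      \<psi> analytic_on {z} \<and> bi_poly P z (\<phi> z) = 0 \<and> bi_poly P z (\<psi> z) = 0"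
    unfolding eventually_nhds_metric by (auto simp: dist_commute)
  have cont: "continuous_on (ball z0 r) \<phi>" "continuous_on (ball z0 r) \<psi>"
    using r(2) analytic_at_imp_isCont by (auto intro!: continuous_at_imp_continuous_on)
  have "\<forall>\<^sub>F z in nhds z0. z \<in> ball z0 r" using r(1) by (intro eventually_nhds_in_open) auto
  then show ?thesis
  proof eventually_elim
    case (elim z)
    show ?case
      by (rule algebraic_function_unique[OF P(1,2), of "ball z0 r" z0 z "\<lambda>z. z"])
         (use r elim cont eq in auto)
  qed
qed

lemma continues_along_subpath:
  assumes "matrix_germ_family q a b F" "continuous_on {a..b} q" "a \<le> b"
  shows "continues_along (\<lambda>t. q ((b - a) * t + a)) (F a) (F b)"
proof (rule continues_alongI[where F = "\<lambda>t. F ((b - a) * t + a)"])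
  have img: "(\<lambda>t. (b - a) * t + a) ` {0..1} \<subseteq> {a..b}"
  proof -
    have "a \<le> (b - a) * t + a \<and> (b - a) * t + a \<le> b" if "0 \<le> t" "t \<le> 1" for t
      using mult_left_mono[OF that(2), of "b - a"] mult_nonneg_nonneg[of "b - a" t] that assms(3) by simp
    then show ?thesis by auto
  qed
  show "path (\<lambda>t. q ((b - a) * t + a))"
    unfolding path_def
    by (rule continuous_on_compose2[OF assms(2)]) (use img in \<open>auto intro!: continuous_intros\<close>)
  show "matrix_germ_family (\<lambda>t. q ((b - a) * t + a)) 0 1 (\<lambda>t. F ((b - a) * t + a))"
  proof (rule matrix_germ_familyI)
    fix i j
    have "germ_family (q \<circ> (\<lambda>t. (b - a) * t + a)) 0 1 ((\<lambda>t z. F t z $ i $ j) \<circ> (\<lambda>t. (b - a) * t + a))"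
      by (rule germ_family_compose[OF matrix_germ_familyD[OF assms(1)] _ img]) (intro continuous_intros)
    then show "germ_family (\<lambda>t. q ((b - a) * t + a)) 0 1 (\<lambda>t z. F ((b - a) * t + a) z $ i $ j)"
      by (simp add: o_def)
  qed
qed (simp_all add: pathstart_def pathfinish_def)

locale algebraic_branches =
  fixes S :: "complex set" and G :: "('n::finite) matrix_fun" and P :: "'n \<Rightarrow> 'n \<Rightarrow> complex poly poly"
  assumes fin: "finite (critical_points (P i j))" and deg: "degree (P i j) > 0"
    and ann: "reachable S G k g \<Longrightarrow> \<forall>\<^sub>F z in at k. bi_poly (P i j) z (g z $ i $ j) = 0"
begin

definition critical :: "complex set" where
  "critical = (\<Union>i j. critical_points (P i j))"

lemma finite_critical: "finite critical"
  unfolding critical_def using fin by auto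

text \<open>Trivial monodromy is a statement about the matrix germ, so the loop is lifted for every
  entry and the resulting germ families are assembled into one matrix family. Its end germ is g
  again; comparing values at z0 closes the lift of each single entry.\<close>

lemma loop_lift_closed:
  fixes g :: "'n matrix_fun"
  assumes z0: "z0 \<notin> critical"
    and g: "reachable S G z0 g"
    and an: "\<And>i j. \<phi> i j analytic_on {z0}" and eq: "\<And>i j. \<forall>\<^sub>F z in at z0. \<phi> i j z = g z $ i $ j"
    and zero: "\<And>i j. bi_poly (P i j) z0 (\<phi> i j z0) = 0"
    and q: "path q" "pathstart q = z0" "pathfinish q = z0" "path_image q \<inter> critical = {}"
    and mono: "\<And>h. continues_along q g h \<Longrightarrow> same_germ z0 g h"
  obtains h where "path h" "path_image h \<subseteq> algebraic_curve (P i j)"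
    "pathstart h = (z0, \<phi> i j z0)" "pathfinish h = (z0, \<phi> i j z0)" "\<And>t. t \<in> {0..1} \<Longrightarrow> fst (h t) = q t"
proof -
  let ?a = "\<lambda>i j. (z0, \<phi> i j z0)"
  have nc: "z0 \<notin> critical_points (P i j)" for i j using z0 by (auto simp: critical_def)
  have qc: "path_image q \<inter> critical_points (P i j) = {}" for i j using q(4) by (auto simp: critical_def)
  have \<phi>zero: "\<forall>\<^sub>F z in nhds z0. bi_poly (P i j) z (\<phi> i j z) = 0" for i j
  proof -
    have "\<forall>\<^sub>F z in at z0. bi_poly (P i j) z (\<phi> i j z) = 0"
      using eq[of i j] ann[OF g, of i j] by eventually_elim simp
    then show ?thesis using zero by (simp add: eventually_nhds_conv_at)
  qed
  have "\<exists>h. path h \<and> path_image h \<subseteq> algebraic_curve (P i j) \<and> pathstart h = ?a i j \<and>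
      (\<forall>t\<in>{0..1}. fst (h t) = q t)" for i j
  proof -
    have "?a i j \<in> algebraic_curve (P i j)" using zero nc by (simp add: algebraic_curve_def)
    moreover have "path_image q \<subseteq> - critical_points (P i j)" using qc by blast
    moreover have "pathstart q = fst (?a i j)" using q by simp
    ultimately obtain h where "path h" "path_image h \<subseteq> algebraic_curve (P i j)"
      "pathstart h = ?a i j" "\<And>t. t \<in> {0..1} \<Longrightarrow> fst (h t) = q t"
      using covering_space_lift_path_strong[OF covering_space_algebraic_curve[OF fin[of i j] deg[of i j]], of "?a i j" q] q(1)
      by blast
    then show ?thesis by blast
  qed
  then have "\<forall>i j. \<exists>h. path h \<and> path_image h \<subseteq> algebraic_curve (P i j) \<and> pathstart h = ?a i j \<and>
      (\<forall>t\<in>{0..1}. fst (h t) = q t)" by blast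
  from choice2[OF this]
  obtain h where h: "\<And>i j. path (h i j)" "\<And>i j. path_image (h i j) \<subseteq> algebraic_curve (P i j)"
    "\<And>i j. pathstart (h i j) = ?a i j" "\<And>i j t. t \<in> {0..1} \<Longrightarrow> fst (h i j t) = q t"
    by blast
  have "\<exists>\<Phi>. germ_family q 0 1 \<Phi> \<and> (\<forall>t\<in>{0..1}. \<Phi> t analytic_on {q t} \<and> \<Phi> t (q t) = snd (h i j t) \<and>
      (\<forall>\<^sub>F z in nhds (q t). bi_poly (P i j) z (\<Phi> t z) = 0))" for i j
  proof -
    have snd_h: "path (\<lambda>t. snd (h i j t))"
      using h(1)[of i j] unfolding path_def by (intro continuous_intros)
    show ?thesis
    proof (rule lifted_path_germ_family[OF fin[of i j] deg[of i j] q(1) snd_h qc[of i j]])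
      fix t :: real assume t: "t \<in> {0..1}"
      have "h i j t \<in> algebraic_curve (P i j)" using h(2) t unfolding path_image_def by blast
      then show "bi_poly (P i j) (q t) (snd (h i j t)) = 0"
        using h(4)[OF t, of i j] by (auto simp: algebraic_curve_def split: prod.splits)
    qed blast
  qed
  then have "\<forall>i j. \<exists>\<Phi>. germ_family q 0 1 \<Phi> \<and> (\<forall>t\<in>{0..1}. \<Phi> t analytic_on {q t} \<and> \<Phi> t (q t) = snd (h i j t) \<and>
      (\<forall>\<^sub>F z in nhds (q t). bi_poly (P i j) z (\<Phi> t z) = 0))" by blast
  from choice2[OF this]
  obtain \<Phi> where \<Phi>: "\<And>i j. germ_family q 0 1 (\<Phi> i j)"
    "\<And>i j t. t \<in> {0..1} \<Longrightarrow> \<Phi> i j t analytic_on {q t}"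
    "\<And>i j t. t \<in> {0..1} \<Longrightarrow> \<Phi> i j t (q t) = snd (h i j t)"
    "\<And>i j t. t \<in> {0..1} \<Longrightarrow> \<forall>\<^sub>F z in nhds (q t). bi_poly (P i j) z (\<Phi> i j t z) = 0"
    by blast
  define F where "F t z = (\<chi> i j. \<Phi> i j t z)" for t z
  have q01: "q 0 = z0" "q 1 = z0" using q by (auto simp: pathstart_def pathfinish_def)
  have "continues_along q g (F 1)"
  proof (rule continues_alongI[where F = F])
    show "matrix_germ_family q 0 1 F"
      using \<Phi>(1) by (intro matrix_germ_familyI) (simp add: F_def)
    have "\<forall>\<^sub>F z in at z0. \<Phi> i j 0 z = g z $ i $ j" for i j
    proof -
      have "\<forall>\<^sub>F z in nhds z0. \<Phi> i j 0 z = \<phi> i j z"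
      proof (rule algebraic_function_germ_unique[OF fin deg nc _ an _ \<phi>zero])
        show "\<Phi> i j 0 z0 = \<phi> i j z0"
          using \<Phi>(3)[of 0 i j] q01 h(3)[of i j] by (simp add: pathstart_def)
      qed (use \<Phi>(2,4)[of 0 i j] q01 in auto)
      then have "\<forall>\<^sub>F z in at z0. \<Phi> i j 0 z = \<phi> i j z" by (rule filter_leD[OF at_within_le_nhds])
      then show ?thesis using eq[of i j] by eventually_elim simp
    qed
    then show "same_germ (pathstart q) (F 0) g"
      using q by (simp add: same_germ_entrywise F_def)
  qed (use q in auto)
  then have "same_germ z0 g (F 1)" by (rule mono)
  then have g1: "\<forall>\<^sub>F z in at z0. g z $ i $ j = \<Phi> i j 1 z" by (simp add: same_germ_entrywise F_def)
  have "\<phi> i j z0 = \<Phi> i j 1 z0"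
  proof -
    have "(\<phi> i j \<longlongrightarrow> \<phi> i j z0) (at z0)" "(\<Phi> i j 1 \<longlongrightarrow> \<Phi> i j 1 z0) (at z0)"
      using analytic_at_imp_isCont[OF an[of i j]] analytic_at_imp_isCont[OF \<Phi>(2)[of 1 i j]] q01
      by (auto simp: isCont_def)
    moreover have "\<forall>\<^sub>F z in at z0. \<phi> i j z = \<Phi> i j 1 z"
      using eq[of i j] g1 by eventually_elim simp
    ultimately show ?thesis
      using tendsto_unique[OF trivial_limit_at] tendsto_cong by blast
  qed
  then have "pathfinish (h i j) = (z0, \<phi> i j z0)"
    using \<Phi>(3)[of 1 i j] h(4)[of 1 i j] q01 by (simp add: pathfinish_def prod_eq_iff)
  then show ?thesis using that[of "h i j"] h by blast
qed

text \<open>The punctured disc is not simply connected, so the general lifting criterion is used: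
  every loop has a closed lift, hence the inclusion of the punctured disc lifts to the curve. At the
  centre the resulting single-valued roots are meromorphic.\<close>

lemma punctured_ball_branch:
  fixes g :: "'n matrix_fun"
  assumes r: "r > 0" "(ball z0 r - {z0}) \<inter> critical = {}"
    and mono: "\<And>q g h. reachable S G (pathstart q) g \<Longrightarrow> pathfinish q = pathstart q \<Longrightarrow>
      path_image q \<subseteq> ball z0 r - {z0} \<Longrightarrow> continues_along q g h \<Longrightarrow> same_germ (pathstart q) g h"
    and z1: "z1 \<in> ball z0 r - {z0}" and g: "reachable S G z1 g"
  obtains F where "meromorphic_matrix_on F (ball z0 r)" "same_germ z1 F g"
proof -
  let ?B = "ball z0 r - {z0}"
  have z1c: "z1 \<notin> critical" using z1 r by blast
  have nc: "z1 \<notin> critical_points (P i j)" for i j using z1c by (auto simp: critical_def)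
  have Bc: "?B \<inter> critical_points (P i j) = {}" for i j using r(2) by (auto simp: critical_def)
  have gm: "(\<lambda>z. g z $ i $ j) meromorphic_on {z1}" for i j
    using reachable_meromorphic[OF g] by (simp add: meromorphic_matrix_on_def)
  have "\<forall>i j. \<exists>\<phi>. \<phi> analytic_on {z1} \<and> (\<forall>\<^sub>F z in at z1. \<phi> z = g z $ i $ j) \<and> bi_poly (P i j) z1 (\<phi> z1) = 0"
  proof (intro allI)
    fix i j
    show "\<exists>\<phi>. \<phi> analytic_on {z1} \<and> (\<forall>\<^sub>F z in at z1. \<phi> z = g z $ i $ j) \<and> bi_poly (P i j) z1 (\<phi> z1) = 0"
      by (rule algebraic_germ_regular[OF gm[of i j] nc[of i j] deg[of i j] ann[OF g, of i j]]) blast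
  qed
  from choice2[OF this]
  obtain \<phi> where \<phi>: "\<And>i j. \<phi> i j analytic_on {z1}" "\<And>i j. \<forall>\<^sub>F z in at z1. \<phi> i j z = g z $ i $ j"
      "\<And>i j. bi_poly (P i j) z1 (\<phi> i j z1) = 0"
    by blast
  have conB: "path_connected ?B" "locally path_connected ?B"
    by (auto intro!: path_connected_punctured_ball open_imp_locally_path_connected)
  have "\<forall>i j. \<exists>s. continuous_on ?B s \<and> s z1 = \<phi> i j z1 \<and> (\<forall>z\<in>?B. bi_poly (P i j) z (s z) = 0)"
  proof (intro allI)
    fix i j
    have loops: "\<exists>h. path h \<and> path_image h \<subseteq> algebraic_curve (P i j) \<and> pathstart h = (z1, \<phi> i j z1) \<and>
        pathfinish h = (z1, \<phi> i j z1) \<and> homotopic_paths (- critical_points (P i j)) ((\<lambda>z. z) \<circ> q) (fst \<circ> h)"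
      if q: "path q" "path_image q \<subseteq> ?B" "pathstart q = z1" "pathfinish q = z1" for q
    proof -
      have qc: "path_image q \<inter> critical = {}" using q(2) r(2) by blast
      have triv: "same_germ z1 g h" if "continues_along q g h" for h
        using mono[of q g h] g q that by simp
      obtain h where h: "path h" "path_image h \<subseteq> algebraic_curve (P i j)"
        "pathstart h = (z1, \<phi> i j z1)" "pathfinish h = (z1, \<phi> i j z1)" "\<And>t. t \<in> {0..1} \<Longrightarrow> fst (h t) = q t"
        by (rule loop_lift_closed[OF z1c g \<phi> q(1,3,4) qc triv, where i = i and j = j]) (assumption, rule that)
      \<comment> \<open>The criterion asks for a lift up to homotopy; here the projection of h is q
        itself at every time.\<close>
      have "homotopic_paths (- critical_points (P i j)) ((\<lambda>z. z) \<circ> q) (fst \<circ> h)"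
      proof (rule homotopic_paths_eq)
        show "path ((\<lambda>z. z) \<circ> q)" using q(1) by (simp add: o_def)
        show "path_image ((\<lambda>z. z) \<circ> q) \<subseteq> - critical_points (P i j)"
          using q(2) Bc[of i j] by (auto simp: o_def)
      qed (use h(5) in auto)
      with h show ?thesis by blast
    qed
    have "(z1, \<phi> i j z1) \<in> algebraic_curve (P i j)"
      using nc \<phi>(3) by (simp add: algebraic_curve_def)
    moreover have "(\<lambda>z. z) \<in> ?B \<rightarrow> - critical_points (P i j)" using Bc by blast
    ultimately obtain s where s: "continuous_on ?B s" "s \<in> ?B \<rightarrow> algebraic_curve (P i j)"
      "s z1 = (z1, \<phi> i j z1)" "\<And>y. y \<in> ?B \<Longrightarrow> fst (s y) = y"
      by (rule covering_space_lift_general[OF covering_space_algebraic_curve[OF fin[of i j] deg[of i j]]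
          _ z1 conB continuous_on_id _ _ loops]) (simp, assumption+, rule that)
    have "bi_poly (P i j) z (snd (s z)) = 0" if "z \<in> ?B" for z
      using s(2,4) that by (force simp: algebraic_curve_def)
    then show "\<exists>s. continuous_on ?B s \<and> s z1 = \<phi> i j z1 \<and> (\<forall>z\<in>?B. bi_poly (P i j) z (s z) = 0)"
      using s by (intro exI[of _ "\<lambda>z. snd (s z)"]) (auto intro!: continuous_intros)
  qed
  from choice2[OF this]
  obtain s where s: "\<And>i j. continuous_on ?B (s i j)" "\<And>i j. s i j z1 = \<phi> i j z1"
      "\<And>i j z. z \<in> ?B \<Longrightarrow> bi_poly (P i j) z (s i j z) = 0"
    by blast
  have hol: "s i j holomorphic_on ?B" for i j
    using algebraic_function_holomorphic[OF _ Bc[of i j] s(1,3)] by (simp add: open_delete)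
  have an: "s i j analytic_on {z}" if "z \<in> ?B" for i j z
    using hol[of i j] that by (meson analytic_at open_ball open_delete)
  have mer: "s i j meromorphic_on ball z0 r" for i j
    unfolding meromorphic_on_meromorphic_at[of _ "ball z0 r"]
  proof
    fix z assume "z \<in> ball z0 r"
    then show "s i j meromorphic_on {z}"
      using algebraic_function_meromorphic(1)[OF r(1) deg hol s(3)] an[of z i j]
      by (cases "z = z0") (auto intro: analytic_on_imp_meromorphic_on)
  qed
  have "\<forall>\<^sub>F z in at z1. s i j z = g z $ i $ j" for i j
  proof -
    have "\<forall>\<^sub>F z in nhds z1. z \<in> ?B" using z1 by (intro eventually_nhds_in_open) auto
    then have "\<forall>\<^sub>F z in nhds z1. bi_poly (P i j) z (s i j z) = 0"
      by eventually_elim (rule s(3))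
    moreover have "\<forall>\<^sub>F z in at z1. bi_poly (P i j) z (\<phi> i j z) = 0"
      using \<phi>(2)[of i j] ann[OF g, of i j] by eventually_elim simp
    then have "\<forall>\<^sub>F z in nhds z1. bi_poly (P i j) z (\<phi> i j z) = 0"
      using \<phi>(3) by (simp add: eventually_nhds_conv_at)
    ultimately have "\<forall>\<^sub>F z in nhds z1. s i j z = \<phi> i j z"
      using algebraic_function_germ_unique[OF fin deg nc an[OF z1] \<phi>(1)] s(2) by blast
    then have "\<forall>\<^sub>F z in at z1. s i j z = \<phi> i j z" by (rule filter_leD[OF at_within_le_nhds])
    then show ?thesis using \<phi>(2)[of i j] by eventually_elim simp
  qed
  then show ?thesis
    using mer by (intro that[of "\<lambda>z. \<chi> i j. s i j z"]) (auto simp: meromorphic_matrix_on_def same_germ_entrywise)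
qed

text \<open>The radius is bounded by r0, within which no monodromy occurs, and by the distance r1 to
  the other critical points. A germ at the centre is first moved to a point of the punctured
  disc.\<close>

lemma ball_branch:
  assumes "z0 \<notin> branch_points S G"
  obtains r where "r > 0" "\<And>z1 g. z1 \<in> ball z0 r \<Longrightarrow> reachable S G z1 g \<Longrightarrow>
    \<exists>F. meromorphic_matrix_on F (ball z0 r) \<and> same_germ z1 F g"
proof -
  obtain r0 where r0: "r0 > 0" and mono0: "\<And>p q g h. pathstart p \<in> S \<Longrightarrow> continues_along p G g \<Longrightarrow>
     pathstart q = pathfinish p \<Longrightarrow> pathfinish q = pathfinish p \<Longrightarrow>
     path_image q \<subseteq> ball z0 r0 - {z0} \<Longrightarrow> continues_along q g h \<Longrightarrow> same_germ (pathfinish p) g h"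
    using assms unfolding branch_points_def by blast
  obtain r1 where r1: "r1 > 0" "\<And>x. x \<in> critical \<Longrightarrow> x \<noteq> z0 \<Longrightarrow> r1 \<le> dist z0 x"
    using finite_set_avoid[OF finite_critical, of z0] by blast
  define r where "r = min r0 r1"
  have r: "r > 0" "(ball z0 r - {z0}) \<inter> critical = {}"
    using r0 r1 unfolding r_def by (auto simp: not_less dest: r1(2))
  have mono: "same_germ (pathstart q) g h"
    if qgh: "reachable S G (pathstart q) g" "pathfinish q = pathstart q"
      "path_image q \<subseteq> ball z0 r - {z0}" "continues_along q g h" for q g h
  proof -
    obtain p where "pathstart p \<in> S" "pathfinish p = pathstart q" "continues_along p G g"
      using qgh(1) unfolding reachable_def by blast
    moreover have "path_image q \<subseteq> ball z0 r0 - {z0}" using qgh(3) by (auto simp: r_def)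
    ultimately show ?thesis using mono0[of p g q h] qgh by simp
  qed
  show ?thesis
  proof (rule that[OF r(1)])
    fix z1 g assume z1: "z1 \<in> ball z0 r" and g: "reachable S G z1 g"
    show "\<exists>F. meromorphic_matrix_on F (ball z0 r) \<and> same_germ z1 F g"
    proof (cases "z1 = z0")
      case False
      then have "z1 \<in> ball z0 r - {z0}" using z1 by blast
      from punctured_ball_branch[OF r mono this g] show ?thesis by blast
    next
      case True
      obtain \<rho> where \<rho>: "\<rho> > 0" "meromorphic_matrix_on g (ball z0 \<rho>)"
        by (rule meromorphic_matrix_on_nhd[OF reachable_meromorphic[OF g[unfolded True]]])
      \<comment> \<open>Half the smaller radius places z2 off the centre and inside both discs, so
        the segment from z0 to z2 carries g as well as the branch F. Agreement at z2 then returns to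
        z0.\<close>
      define z2 where "z2 = z0 + of_real (min \<rho> r / 2)"
      have z2: "z2 \<in> ball z0 \<rho>" "z2 \<in> ball z0 r - {z0}"
        using \<rho>(1) r(1) by (auto simp: z2_def dist_norm norm_of_real)
      have seg: "closed_segment z0 z2 \<subseteq> ball z0 \<rho>" "closed_segment z0 z2 \<subseteq> ball z0 r"
        by (intro closed_segment_subset convex_ball; use z2 \<rho> r in simp)+
      have const: "continues_along (linepath z0 z2) f f"
        if "meromorphic_matrix_on f (ball z0 s)" "closed_segment z0 z2 \<subseteq> ball z0 s" for f :: "'n matrix_fun" and s
        using that by (intro continues_along_const) (auto simp: meromorphic_matrix_on_def intro: meromorphic_on_subset)
      have "reachable S G z2 g"
        using reachable_extend[OF _ const[OF \<rho>(2) seg(1)], of S G] g True by simp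
      from punctured_ball_branch[OF r mono z2(2) this]
      obtain F where F: "meromorphic_matrix_on F (ball z0 r)" "same_germ z2 F g" by blast
      have "same_germ z0 F g"
        using continues_along_same_germ_iff[OF const[OF F(1) seg(2)] const[OF \<rho>(2) seg(1)]] F(2) by simp
      with F(1) True show ?thesis by blast
    qed
  qed
qed

text \<open>By bisection of [0, 1]: near each time the path stays in a disc where any reachable germ
  has a meromorphic representative on the whole disc, and continuations over adjacent intervals can
  be glued.\<close>

lemma continuation_exists:
  assumes q: "path q" "path_image q \<inter> branch_points S G = {}" and g: "reachable S G (pathstart q) g"
  obtains h where "continues_along q g h"
proof -
  have qc: "continuous_on {0..1} q" using q by (simp add: path_def)
  \<comment> \<open>The property quantifies over all reachable germs at the left end, because the
    germ arriving at a junction is not known in advance.\<close>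
  define Q where "Q a b \<longleftrightarrow> (0 \<le> a \<longrightarrow> b \<le> 1 \<longrightarrow> a \<le> b \<longrightarrow> (\<forall>g. reachable S G (q a) g \<longrightarrow>
      (\<exists>F. matrix_germ_family q a b F \<and> same_germ (q a) (F a) g)))" for a b :: real
  have "Q 0 1"
  proof (rule Bolzano)
    fix a b c :: real
    assume ab: "Q a b" and bc: "Q b c" and le: "a \<le> b" "b \<le> c"
    show "Q a c"
      unfolding Q_def
    proof (intro impI allI)
      fix g assume *: "0 \<le> a" "c \<le> 1" "a \<le> c" and g: "reachable S G (q a) g"
      have qc': "continuous_on {a..b} q" "continuous_on {a..c} q"
        using * le by (auto intro: continuous_on_subset[OF qc])
      obtain F where F: "matrix_germ_family q a b F" "same_germ (q a) (F a) g"
        using ab * le g unfolding Q_def by force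
      have "reachable S G (q b) (F b)"
        using reachable_extend[OF _ continues_along_subpath[OF F(1) qc'(1) le(1)], of S G]
          reachable_cong[OF g same_germ_sym[OF F(2)]]
        by (simp add: pathstart_def pathfinish_def)
      then obtain H where H: "matrix_germ_family q b c H" "same_germ (q b) (H b) (F b)"
        using bc * le unfolding Q_def by force
      let ?K = "\<lambda>t. if t \<le> b then F t else H t"
      have "matrix_germ_family q a c ?K"
      proof (rule matrix_germ_familyI)
        fix i j
        have "germ_family q a c (\<lambda>t. if t \<le> b then \<lambda>z. F t z $ i $ j else (\<lambda>z. H t z $ i $ j))"
          using germ_family_glue[OF matrix_germ_familyD[OF F(1), of i j] matrix_germ_familyD[OF H(1), of i j] _ le qc'(2)]
            same_germ_sym[OF H(2)] by (simp add: same_germ_entrywise)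
        then show "germ_family q a c (\<lambda>t z. ?K t z $ i $ j)"
          by (rule germ_family_cong) auto
      qed
      with F(2) le show "\<exists>F. matrix_germ_family q a c F \<and> same_germ (q a) (F a) g"
        by (intro exI[of _ ?K]) simp
    qed
  next
    fix x :: real assume x: "0 \<le> x" "x \<le> 1"
    then have "q x \<in> path_image q" by (simp add: path_image_def)
    then have "q x \<notin> branch_points S G" using q(2) by blast
    from ball_branch[OF this] obtain r where r: "r > 0" "\<And>z1 g. z1 \<in> ball (q x) r \<Longrightarrow> reachable S G z1 g \<Longrightarrow>
        \<exists>F. meromorphic_matrix_on F (ball (q x) r) \<and> same_germ z1 F g" by blast
    obtain d where d: "d > 0" "\<And>s. s \<in> {0..1} \<Longrightarrow> dist s x < d \<Longrightarrow> dist (q s) (q x) < r"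
      using qc x r(1) unfolding continuous_on_iff by (meson atLeastAtMost_iff)
    show "\<exists>d>0. \<forall>a b. a \<le> x \<and> x \<le> b \<and> b - a < d \<longrightarrow> Q a b"
      unfolding Q_def
    proof (intro exI[of _ d] conjI allI impI)
      fix a b g assume ab: "a \<le> x \<and> x \<le> b \<and> b - a < d" "0 \<le> a" "b \<le> 1" "a \<le> b"
        and g: "reachable S G (q a) g"
      have img: "q ` {a..b} \<subseteq> ball (q x) r"
      proof
        fix y assume "y \<in> q ` {a..b}"
        then obtain s where s: "s \<in> {a..b}" "y = q s" by blast
        then have "dist (q s) (q x) < r" using ab by (intro d(2)) (auto simp: dist_real_def)
        then show "y \<in> ball (q x) r" using s by (simp add: dist_commute)
      qed
      moreover have "q a \<in> q ` {a..b}" using ab by simp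
      ultimately have "q a \<in> ball (q x) r" by (rule subsetD)
      from r(2)[OF this g] obtain F where F: "meromorphic_matrix_on F (ball (q x) r)" "same_germ (q a) F g"
        by blast
      then show "\<exists>F. matrix_germ_family q a b F \<and> same_germ (q a) (F a) g"
        using img by (intro exI[of _ "\<lambda>_. F"] conjI matrix_germ_familyI germ_family_const)
          (auto simp: meromorphic_matrix_on_def intro: meromorphic_on_subset)
    qed (rule d(1))
  qed simp
  then obtain F where F: "matrix_germ_family q 0 1 F" "same_germ (q 0) (F 0) g"
    using g unfolding Q_def by (auto simp: pathstart_def)
  then have "continues_along q g (F 1)"
    using q by (intro continues_alongI[where F = F]) (auto simp: pathstart_def)
  then show ?thesis by (rule that)
qed

end

section \<open>Words and bypasses\<close>

lemma strip_subset_half: "strip \<epsilon> \<subseteq> upper_half \<epsilon>" "strip \<epsilon> \<subseteq> lower_half \<epsilon>"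
  by (auto simp: strip_def upper_half_def lower_half_def)

lemma open_strip: "open (strip \<epsilon>)"
  unfolding strip_def by (intro open_Collect_conj open_Collect_less continuous_intros)

lemma convex_strip: "convex (strip \<epsilon>)"
proof -
  have "strip \<epsilon> = {z. Im z > - \<epsilon>} \<inter> {z. Im z < \<epsilon>}" by (auto simp: strip_def)
  then show ?thesis by (simp add: convex_Int convex_halfspace_Im_gt convex_halfspace_Im_lt)
qed

lemma eventually_in_strip: "k \<in> strip \<epsilon> \<Longrightarrow> \<forall>\<^sub>F z in at k. z \<in> strip \<epsilon>"
  using eventually_nhds_in_open[OF open_strip] filter_leD[OF at_within_le_nhds] by blast

lemma meromorphic_matrix_on_subset:
  "meromorphic_matrix_on f A \<Longrightarrow> B \<subseteq> A \<Longrightarrow> meromorphic_matrix_on f B"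
  unfolding meromorphic_matrix_on_def using meromorphic_on_subset by blast

lemma continues_along_linepath:
  assumes "meromorphic_matrix_on f A" "convex A" "a \<in> A" "b \<in> A"
  shows "continues_along (linepath a b) f f"
proof (rule continues_along_const)
  show "meromorphic_matrix_on f (path_image (linepath a b))"
    using assms by (intro meromorphic_matrix_on_subset[OF assms(1)]) (simp add: closed_segment_subset)
qed simp

text \<open>Minimal polynomials are taken for the germ at 0. Every reachable germ arises from it by
  a segment in the strip followed by a path, and the equation persists along both.\<close>

lemma algebraic_matrix_branches:
  fixes G :: "('n::finite) matrix_fun"
  assumes "0 < \<epsilon>" and alg: "algebraic_matrix_on (strip \<epsilon>) G"
  obtains P where "algebraic_branches (strip \<epsilon>) G P"
proof -
  have zero: "0 \<in> strip \<epsilon>" using assms(1) by (simp add: strip_def)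
  have mer: "(\<lambda>z. G z $ i $ j) meromorphic_on strip \<epsilon>" for i j
    using alg unfolding algebraic_matrix_on_def nicely_meromorphic_on_def by blast
  have Gm: "meromorphic_matrix_on G (strip \<epsilon>)" using mer by (simp add: meromorphic_matrix_on_def)
  have "\<forall>i j. \<exists>P. degree P > 0 \<and> finite (critical_points P) \<and> (\<forall>\<^sub>F z in at 0. bi_poly P z (G z $ i $ j) = 0)"
  proof (intro allI)
    fix i j
    obtain P0 :: "complex poly poly" where P0: "P0 \<noteq> 0" "\<And>z. z \<in> strip \<epsilon> \<Longrightarrow> \<not> is_pole (\<lambda>u. G u $ i $ j) z \<Longrightarrow> bi_poly P0 z (G z $ i $ j) = 0"
      using alg unfolding algebraic_matrix_on_def bi_poly_def by blast
    have mer0: "(\<lambda>z. G z $ i $ j) meromorphic_on {0}" using mer zero by (auto intro: meromorphic_on_subset)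
    have "\<forall>\<^sub>F z in at 0. \<forall>i j. (\<lambda>w. G w $ i $ j) analytic_on {z}"
      using meromorphic_matrix_on_eventually meromorphic_matrix_on_subset[OF Gm] zero by blast
    \<comment> \<open>The given equation is imposed off the poles only. Poles are isolated, so it
      holds on a punctured neighbourhood of 0 even if 0 is itself a pole.\<close>
    with eventually_in_strip[OF zero] have ev: "\<forall>\<^sub>F z in at 0. bi_poly P0 z (G z $ i $ j) = 0"
      by eventually_elim (use P0(2) analytic_at_imp_no_pole in blast)
    show "\<exists>P. degree P > 0 \<and> finite (critical_points P) \<and> (\<forall>\<^sub>F z in at 0. bi_poly P z (G z $ i $ j) = 0)"
      by (rule algebraic_germ_minimal_poly[OF mer0 P0(1) ev]) blast
  qed
  from choice2[OF this] obtain P where P: "\<And>i j. degree (P i j) > 0" "\<And>i j. finite (critical_points (P i j))"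
    "\<And>i j. \<forall>\<^sub>F z in at 0. bi_poly (P i j) z (G z $ i $ j) = 0" by blast
  have "algebraic_branches (strip \<epsilon>) G P"
  proof
    fix k and g :: "'n matrix_fun" and i j
    assume "reachable (strip \<epsilon>) G k g"
    then obtain p where p: "pathstart p \<in> strip \<epsilon>" "pathfinish p = k" "continues_along p G g"
      unfolding reachable_def by blast
    have "continues_along (linepath 0 (pathstart p)) G G"
      by (rule continues_along_linepath[OF Gm convex_strip zero p(1)])
    from continues_along_bi_poly_iff[OF this, of "P i j" i j] continues_along_bi_poly_iff[OF p(3), of "P i j" i j]
    show "\<forall>\<^sub>F z in at k. bi_poly (P i j) z (g z $ i $ j) = 0"
      using P(3)[of i j] p(2) by simp
  qed (use P in auto)
  then show ?thesis by (rule that)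
qed

text \<open>Finitely many pairwise distinct germs have pairwise distinct values at a common
  noncritical point, and each entry takes one of \<open>degree (P i j)\<close> roots there.\<close>

lemma (in algebraic_branches) pigeonhole_germs:
  fixes g :: "nat \<Rightarrow> 'n matrix_fun"
  assumes reach: "\<And>n. reachable S G k (g n)"
  obtains m n where "m < n" "same_germ k (g m) (g n)"
proof -
  \<comment> \<open>M bounds the number of possible matrices at a noncritical point; the indices up
    to M already give M + 1 germs.\<close>
  define M where "M = (\<Prod>(i, j)\<in>UNIV. degree (P i j))"
  have "\<exists>m n. m < n \<and> same_germ k (g m) (g n)"
  proof (rule ccontr)
    assume neg: "\<not> ?thesis"
    have diff: "\<forall>\<^sub>F z in at k. g m z \<noteq> g n z" if mn: "m \<noteq> n" for m n
    proof -
      have "\<not> same_germ k (g m) (g n)"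
        using neg same_germ_sym mn by (cases m n rule: linorder_cases) blast+
      then obtain i j where ij: "\<not> (\<forall>\<^sub>F z in at k. g m z $ i $ j = g n z $ i $ j)"
        unfolding same_germ_entrywise by blast
      have "(\<lambda>z. g m z $ i $ j - g n z $ i $ j) meromorphic_on {k}"
        using reachable_meromorphic[OF reach] by (intro meromorphic_intros) (simp_all add: meromorphic_matrix_on_def)
      from meromorphic_on_eventually_zero_or_nonzero[OF this] ij
      have "\<forall>\<^sub>F z in at k. g m z $ i $ j - g n z $ i $ j \<noteq> 0" by simp
      then show ?thesis by eventually_elim auto
    qed
    have "\<forall>\<^sub>F z in at k. \<forall>m\<in>{..M}. \<forall>n\<in>{..M}. m \<noteq> n \<longrightarrow> g m z \<noteq> g n z"
      using diff by (intro eventually_ball_finite ballI) (auto intro: eventually_mono)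
    moreover have "\<forall>\<^sub>F z in at k. \<forall>n\<in>{..M}. \<forall>i j. bi_poly (P i j) z (g n z $ i $ j) = 0"
      using ann[OF reach] by (intro eventually_ball_finite ballI) (simp_all add: eventually_all_iff)
    moreover have "\<forall>\<^sub>F z in at k. z \<notin> critical"
      using islimpt_finite[OF finite_critical, of k] by (simp add: islimpt_conv_frequently_at frequently_def)
    ultimately have "\<forall>\<^sub>F z in at k. (\<forall>m\<in>{..M}. \<forall>n\<in>{..M}. m \<noteq> n \<longrightarrow> g m z \<noteq> g n z) \<and>
        (\<forall>n\<in>{..M}. \<forall>i j. bi_poly (P i j) z (g n z $ i $ j) = 0) \<and> z \<notin> critical"
      by eventually_elim blast
    then have "\<exists>z. (\<forall>m\<in>{..M}. \<forall>n\<in>{..M}. m \<noteq> n \<longrightarrow> g m z \<noteq> g n z) \<and>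
        (\<forall>n\<in>{..M}. \<forall>i j. bi_poly (P i j) z (g n z $ i $ j) = 0) \<and> z \<notin> critical"
      by (rule eventually_happens'[OF trivial_limit_at])
    then obtain z where "(\<forall>m\<in>{..M}. \<forall>n\<in>{..M}. m \<noteq> n \<longrightarrow> g m z \<noteq> g n z) \<and>
        (\<forall>n\<in>{..M}. \<forall>i j. bi_poly (P i j) z (g n z $ i $ j) = 0) \<and> z \<notin> critical"
      by (rule exE)
    then have z: "\<And>m n. m \<in> {..M} \<Longrightarrow> n \<in> {..M} \<Longrightarrow> m \<noteq> n \<Longrightarrow> g m z \<noteq> g n z"
        "\<And>n i j. n \<in> {..M} \<Longrightarrow> bi_poly (P i j) z (g n z $ i $ j) = 0" "z \<notin> critical"
      by blast+
    have nc: "z \<notin> critical_points (P i j)" for i j using z(3) by (auto simp: critical_def)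
    let ?R = "\<lambda>(i, j). {w. bi_poly (P i j) z w = 0}"
    let ?f = "\<lambda>n. \<lambda>(i, j)\<in>UNIV. g n z $ i $ j"
    have "inj_on ?f {..M}"
    proof (rule inj_onI)
      fix m n assume mn: "m \<in> {..M}" "n \<in> {..M}" "?f m = ?f n"
      have "g m z $ i $ j = g n z $ i $ j" for i j
        using fun_cong[OF mn(3), of "(i, j)"] by simp
      then have "g m z = g n z" by (simp add: vec_eq_iff)
      then show "m = n" using z(1) mn by blast
    qed
    moreover have "?f ` {..M} \<subseteq> PiE UNIV ?R" using z(2) by (auto simp: PiE_iff)
    moreover have "finite (PiE UNIV ?R)"
      using roots_card_noncritical(1)[OF nc] by (intro finite_PiE) auto
    ultimately have "card {..M} \<le> card (PiE UNIV ?R)" by (rule card_inj_on_le)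
    also have "card (PiE UNIV ?R) = M"
      unfolding M_def by (subst card_PiE) (auto intro!: prod.cong simp: roots_card_noncritical(2)[OF nc])
    finally show False by simp
  qed
  then show ?thesis using that by blast
qed

section \<open>Cuts, and change of the base point of a bypass\<close>

lemma cut_outside_strip:
  assumes "cut_system \<epsilon> T \<gamma>" "T \<inter> strip \<epsilon> = {}" "\<tau> \<in> T"
  shows "\<gamma> \<tau> ` {0..} \<inter> strip \<epsilon> = {}"
proof -
  have "\<tau> \<notin> strip \<epsilon>" using assms by blast
  moreover have "Im \<tau> = 0 \<Longrightarrow> 0 < \<epsilon> \<Longrightarrow> \<tau> \<in> strip \<epsilon>" by (simp add: strip_def)
  ultimately consider "0 < Im \<tau>" | "Im \<tau> < 0" | "\<epsilon> \<le> 0" by linarith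
  then show ?thesis
  proof cases
    case 1
    then have "\<epsilon> \<le> Im (\<gamma> \<tau> t)" if "t \<ge> 0" for t using assms(1,3) that unfolding cut_system_def by blast
    then show ?thesis by (fastforce simp: strip_def)
  next
    case 2
    then have "Im (\<gamma> \<tau> t) \<le> - \<epsilon>" if "t \<ge> 0" for t using assms(1,3) that unfolding cut_system_def by blast
    then show ?thesis by (fastforce simp: strip_def)
  qed (auto simp: strip_def)
qed

text \<open>Each other affix is the initial point of its own cut, which the bypass does not
  meet.\<close>

lemma bypass_avoids_branch_points:
  assumes "cut_system \<epsilon> T \<gamma>" "bypass \<epsilon> T \<gamma> \<tau> k p"
  shows "path_image p \<inter> T = {}"
proof -
  have "\<sigma> \<notin> path_image p" if \<sigma>: "\<sigma> \<in> T" for \<sigma>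
  proof (cases "\<sigma> = \<tau>")
    case True
    then show ?thesis using assms(2) by (simp add: bypass_def)
  next
    case False
    have "\<gamma> \<sigma> 0 = \<sigma>" using assms(1) \<sigma> unfolding cut_system_def by blast
    then have "\<sigma> \<in> \<gamma> \<sigma> ` {0..}" by (metis atLeast_iff imageI order_refl)
    moreover have "path_image p \<inter> \<gamma> \<sigma> ` {0..} = {}"
      using assms(2) \<sigma> False unfolding bypass_def by blast
    ultimately show ?thesis by blast
  qed
  then show ?thesis by blast
qed

lemma ex1_joinpaths_right:
  assumes "\<exists>!t. t \<in> {0..1} \<and> p t \<in> C" "path_image l \<inter> C = {}" "pathfinish l = pathstart p"
  shows "\<exists>!t. t \<in> {0..1} \<and> (l +++ p) t \<in> C"
proof -
  obtain t0 where t0: "t0 \<in> {0..1}" "p t0 \<in> C" "\<And>t. t \<in> {0..1} \<Longrightarrow> p t \<in> C \<Longrightarrow> t = t0"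
    using assms(1) by blast
  have l: "l t \<notin> C" if "t \<in> {0..1}" for t using assms(2) that unfolding path_image_def by blast
  \<comment> \<open>The junction lies on l and hence off C. So t0 is positive, and the hit remains
    in the half of the joined parameter where p is traversed.\<close>
  have "p 0 \<notin> C" using l[of 1] assms(3) by (simp add: pathfinish_def pathstart_def)
  then have "t0 > 0" using t0(1,2) by (cases "t0 = 0") auto
  show ?thesis
  proof (rule ex1I[of _ "(t0 + 1) / 2"])
    show "(t0 + 1) / 2 \<in> {0..1} \<and> (l +++ p) ((t0 + 1) / 2) \<in> C"
      using t0(1,2) \<open>t0 > 0\<close> by (simp add: joinpaths_def field_simps)
    fix t assume t: "t \<in> {0..1} \<and> (l +++ p) t \<in> C"
    then have "\<not> t \<le> 1/2" using l[of "2 * t"] by (auto simp: joinpaths_def)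
    then have "2 * t - 1 = t0" using t t0(3)[of "2 * t - 1"] by (auto simp: joinpaths_def)
    then show "t = (t0 + 1) / 2" by simp
  qed
qed

lemma ex1_joinpaths_left:
  assumes "\<exists>!t. t \<in> {0..1} \<and> p t \<in> C" "path_image l \<inter> C = {}"
  shows "\<exists>!t. t \<in> {0..1} \<and> (p +++ l) t \<in> C"
proof -
  obtain t0 where t0: "t0 \<in> {0..1}" "p t0 \<in> C" "\<And>t. t \<in> {0..1} \<Longrightarrow> p t \<in> C \<Longrightarrow> t = t0"
    using assms(1) by blast
  have l: "l t \<notin> C" if "t \<in> {0..1}" for t using assms(2) that unfolding path_image_def by blast
  show ?thesis
  proof (rule ex1I[of _ "t0 / 2"])
    show "t0 / 2 \<in> {0..1} \<and> (p +++ l) (t0 / 2) \<in> C"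
      using t0(1,2) by (simp add: joinpaths_def)
    fix t assume t: "t \<in> {0..1} \<and> (p +++ l) t \<in> C"
    then have "t \<le> 1/2" using l[of "2 * t - 1"] by (cases "t \<le> 1/2") (auto simp: joinpaths_def)
    then have "2 * t = t0" using t t0(3)[of "2 * t"] by (auto simp: joinpaths_def)
    then show "t = t0 / 2" by simp
  qed
qed

text \<open>The attached segments lie in the strip, where there are no cuts, and their contributions
  to the winding number cancel because one reverses the other.\<close>

lemma bypass_move_base:
  assumes cut: "cut_system \<epsilon> T \<gamma>" "T \<inter> strip \<epsilon> = {}" "\<tau> \<in> T"
    and bp: "bypass \<epsilon> T \<gamma> \<tau> k p" and k: "k \<in> strip \<epsilon>" "z \<in> strip \<epsilon>"
  shows "bypass \<epsilon> T \<gamma> \<tau> z (linepath z k +++ (p +++ linepath k z))"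
proof -
  have seg: "closed_segment z k \<subseteq> strip \<epsilon>" "closed_segment k z \<subseteq> strip \<epsilon>"
    by (intro closed_segment_subset convex_strip k)+
  have p: "path p" "pathstart p = k" "pathfinish p = k"
    "path_image p \<subseteq> (if 0 < Im \<tau> then upper_half \<epsilon> else lower_half \<epsilon>)"
    "\<tau> \<notin> path_image p" "winding_number p \<tau> = 1" "\<exists>!t. t \<in> {0..1} \<and> p t \<in> \<gamma> \<tau> ` {0..}"
    "\<And>\<sigma>. \<sigma> \<in> T - {\<tau>} \<Longrightarrow> path_image p \<inter> \<gamma> \<sigma> ` {0..} = {}"
    using bp unfolding bypass_def by blast+
  have img: "path_image (linepath z k +++ (p +++ linepath k z)) = closed_segment z k \<union> path_image p \<union> closed_segment k z"
    using p(1-3) by (simp add: path_image_join Un_assoc)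
  have cuts: "closed_segment z k \<inter> \<gamma> \<sigma> ` {0..} = {}" "closed_segment k z \<inter> \<gamma> \<sigma> ` {0..} = {}" if "\<sigma> \<in> T" for \<sigma>
    using cut_outside_strip[OF cut(1,2) that] seg by blast+
  have \<tau>: "\<tau> \<notin> closed_segment z k" "\<tau> \<notin> closed_segment k z" using cut seg by blast+
  show ?thesis
    unfolding bypass_def
  proof (intro conjI ballI)
    show "winding_number (linepath z k +++ (p +++ linepath k z)) \<tau> = 1"
    proof -
      have "winding_number (linepath k z) \<tau> = - winding_number (linepath z k) \<tau>"
        using winding_number_reversepath[of "linepath z k" \<tau>] \<tau> by simp
      moreover have "winding_number (p +++ linepath k z) \<tau> = winding_number p \<tau> + winding_number (linepath k z) \<tau>"
        by (rule winding_number_join) (use p \<tau> in auto)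
      moreover have "winding_number (linepath z k +++ (p +++ linepath k z)) \<tau> =
          winding_number (linepath z k) \<tau> + winding_number (p +++ linepath k z) \<tau>"
        by (rule winding_number_join) (use p \<tau> in \<open>auto simp: path_image_join\<close>)
      ultimately show ?thesis using p(6) by simp
    qed
    show "\<exists>!t. t \<in> {0..1} \<and> (linepath z k +++ (p +++ linepath k z)) t \<in> \<gamma> \<tau> ` {0..}"
      using cuts[OF cut(3)] by (intro ex1_joinpaths_right ex1_joinpaths_left p(7)) (simp_all add: p(2))
    show "path_image (linepath z k +++ (p +++ linepath k z)) \<subseteq> (if 0 < Im \<tau> then upper_half \<epsilon> else lower_half \<epsilon>)"
      unfolding img using p(4) seg strip_subset_half[of \<epsilon>] by (simp split: if_splits) blast+
    show "path_image (linepath z k +++ (p +++ linepath k z)) \<inter> \<gamma> \<sigma> ` {0..} = {}" if "\<sigma> \<in> T - {\<tau>}" for \<sigma>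
      unfolding img using cuts[of \<sigma>] p(8)[OF that] that by blast
    show "\<tau> \<notin> path_image (linepath z k +++ (p +++ linepath k z))"
      unfolding img using p(5) \<tau> by blast
  qed (use p(1-3) in simp_all)
qed

section \<open>Continuation along words\<close>

lemma continues_word_cong:
  assumes "continues_word \<epsilon> T \<gamma> w k f g" "same_germ k f' f"
  shows "continues_word \<epsilon> T \<gamma> w k f' g"
proof (cases w)
  case Nil
  then show ?thesis using assms same_germ_trans by (metis continues_word.simps(1))
next
  case (Cons \<tau> v)
  then obtain p h where ph: "bypass \<epsilon> T \<gamma> \<tau> k p" "continues_along p f h" "continues_word \<epsilon> T \<gamma> v k h g"
    using assms(1) by auto
  have "continues_along p f' h"
    using continues_along_cong[OF ph(2) same_germ_sym, of f'] assms(2) ph(1) by (simp add: bypass_def)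
  with ph Cons show ?thesis by auto
qed

lemma continues_word_append:
  "continues_word \<epsilon> T \<gamma> v k f g \<Longrightarrow> continues_word \<epsilon> T \<gamma> w k g h \<Longrightarrow> continues_word \<epsilon> T \<gamma> (v @ w) k f h"
proof (induction v arbitrary: f)
  case Nil
  then show ?case by (auto intro: continues_word_cong)
next
  case (Cons \<tau> v)
  then show ?case by simp blast
qed

lemma continues_word_meromorphic:
  "continues_word \<epsilon> T \<gamma> w k f g \<Longrightarrow> meromorphic_matrix_on f {k} \<Longrightarrow> meromorphic_matrix_on g {k}"
proof (induction w arbitrary: f)
  case Nil
  then show ?case using meromorphic_matrix_on_cong[of k f g] by simp
next
  case (Cons \<tau> w)
  then obtain p h where ph: "bypass \<epsilon> T \<gamma> \<tau> k p" "continues_along p f h" "continues_word \<epsilon> T \<gamma> w k h g"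
    by auto
  then have "meromorphic_matrix_on h {k}"
    using continues_along_meromorphic(2)[OF ph(2)] by (simp add: bypass_def)
  then show ?case using Cons.IH ph(3) by blast
qed

lemma continues_word_reachable:
  "continues_word \<epsilon> T \<gamma> w k f g \<Longrightarrow> reachable S G k f \<Longrightarrow> reachable S G k g"
proof (induction w arbitrary: f)
  case Nil
  then show ?case using reachable_cong by auto
next
  case (Cons \<tau> w)
  then obtain p h where ph: "bypass \<epsilon> T \<gamma> \<tau> k p" "continues_along p f h" "continues_word \<epsilon> T \<gamma> w k h g"
    by auto
  then have "reachable S G k h"
    using reachable_extend[OF _ ph(2), of S G] Cons.prems(2) by (simp add: bypass_def)
  then show ?case using Cons.IH ph(3) by blast
qed

text \<open>Each intermediate germ is represented by one function near k, so a bypass at k may be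
  conjugated by the segment to z. This turns a germ reached at k into values at all nearby points,
  where balancedness can be used.\<close>

lemma continues_word_nearby:
  assumes cut: "cut_system \<epsilon> T \<gamma>" "T \<inter> strip \<epsilon> = {}" and k: "k \<in> strip \<epsilon>"
  shows "w \<in> lists T \<Longrightarrow> continues_word \<epsilon> T \<gamma> w k f g \<Longrightarrow> meromorphic_matrix_on f {k} \<Longrightarrow>
    \<forall>\<^sub>F z in at k. continues_word \<epsilon> T \<gamma> w z f g"
proof (induction w arbitrary: f)
  case Nil
  then have "\<forall>\<^sub>F z in at k. f z = g z" by (simp add: same_germ_def)
  then obtain S where S: "open S" "k \<in> S" "\<And>y. y \<in> S \<Longrightarrow> \<forall>\<^sub>F z in at y. f z = g z"
    by (elim eventually_at_nearby) blast
  then have "\<forall>\<^sub>F z in nhds k. z \<in> S" by (intro eventually_nhds_in_open)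
  then have "\<forall>\<^sub>F z in at k. z \<in> S" by (rule filter_leD[OF at_within_le_nhds])
  then show ?case by eventually_elim (use S in \<open>simp add: same_germ_def\<close>)
next
  case (Cons \<tau> w)
  then obtain p h where ph: "bypass \<epsilon> T \<gamma> \<tau> k p" "continues_along p f h" "continues_word \<epsilon> T \<gamma> w k h g"
    by auto
  have pk: "pathstart p = k" "pathfinish p = k" using ph(1) by (simp_all add: bypass_def)
  have hm: "meromorphic_matrix_on h {k}" using continues_along_meromorphic(2)[OF ph(2)] pk by simp
  obtain r where r: "r > 0" "meromorphic_matrix_on f (ball k r)"
    by (rule meromorphic_matrix_on_nhd[OF Cons.prems(3)])
  obtain s where s: "s > 0" "meromorphic_matrix_on h (ball k s)"
    by (rule meromorphic_matrix_on_nhd[OF hm])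
  have "\<forall>\<^sub>F z in nhds k. z \<in> ball k r \<inter> ball k s" using r s by (intro eventually_nhds_in_open) auto
  then have "\<forall>\<^sub>F z in at k. z \<in> ball k r \<inter> ball k s" by (rule filter_leD[OF at_within_le_nhds])
  moreover have "\<forall>\<^sub>F z in at k. continues_word \<epsilon> T \<gamma> w z h g"
    using Cons.IH[of h] Cons.prems(1) ph(3) hm by auto
  ultimately show ?case using eventually_in_strip[OF k]
  proof eventually_elim
    case (elim z)
    have "continues_along (linepath z k) f f"
      using elim(1) r by (intro continues_along_linepath[OF r(2) convex_ball]) auto
    moreover have "continues_along (linepath k z) h h"
      using elim(1) s by (intro continues_along_linepath[OF s(2) convex_ball]) auto
    ultimately have "continues_along (linepath z k +++ (p +++ linepath k z)) f h"
      using ph(2) pk by (intro continues_along_join[of _ f f] continues_along_join[of p f h]) auto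
    moreover have "bypass \<epsilon> T \<gamma> \<tau> z (linepath z k +++ (p +++ linepath k z))"
      using Cons.prems(1) by (intro bypass_move_base[OF cut _ ph(1) k elim(3)]) auto
    ultimately show ?case using elim(2) by auto
  qed
qed

text \<open>All letters of w belong to one half-plane H, where Q is single-valued. Along each bypass
  Q continues to itself, and commutation is carried over to the continued germ.\<close>

lemma continues_word_commute:
  assumes "meromorphic_matrix_on Q H"
    and "\<And>\<tau>. \<tau> \<in> set w \<Longrightarrow> (if 0 < Im \<tau> then upper_half \<epsilon> else lower_half \<epsilon>) = H"
  shows "continues_word \<epsilon> T \<gamma> w k f g \<Longrightarrow> germs_commute k f Q \<Longrightarrow> germs_commute k g Q"
  using assms(2)
proof (induction w arbitrary: f)
  case Nil
  then show ?case using germs_commute_cong[of k f g Q Q] by simp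
next
  case (Cons \<tau> w)
  then obtain p h where ph: "bypass \<epsilon> T \<gamma> \<tau> k p" "continues_along p f h" "continues_word \<epsilon> T \<gamma> w k h g"
    by auto
  have H: "(if 0 < Im \<tau> then upper_half \<epsilon> else lower_half \<epsilon>) = H" using Cons.prems(3)[of \<tau>] by simp
  have p: "path p" "pathstart p = k" "pathfinish p = k" "path_image p \<subseteq> H"
    using ph(1) unfolding bypass_def H by blast+
  have "continues_along p Q Q"
    using p(1) meromorphic_matrix_on_subset[OF assms(1) p(4)] by (rule continues_along_const)
  from continues_along_commute_iff[OF ph(2) this] have "germs_commute k h Q"
    using Cons.prems(2) p by simp
  with Cons.IH ph(3) Cons.prems(3) show ?case by simp
qed

section \<open>Passage from germs to values\<close>

lemma tendsto_matrix_mult: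
  fixes A :: "'a \<Rightarrow> complex ^ 'n ^ 'm" and B :: "'a \<Rightarrow> complex ^ 'p ^ 'n"
  assumes "(A \<longlongrightarrow> a) F" "(B \<longlongrightarrow> b) F"
  shows "((\<lambda>x. A x ** B x) \<longlongrightarrow> a ** b) F"
  unfolding matrix_matrix_mult_def
  by (intro vec_tendstoI) (simp, intro tendsto_intros assms)

lemma germs_commute_limit:
  assumes "germs_commute k f g" "(f \<longlongrightarrow> A) (at k)" "(g \<longlongrightarrow> B) (at k)"
  shows "A ** B = B ** A"
proof -
  have "((\<lambda>z. f z ** g z) \<longlongrightarrow> A ** B) (at k)" "((\<lambda>z. g z ** f z) \<longlongrightarrow> B ** A) (at k)"
    using assms by (auto intro: tendsto_matrix_mult)
  moreover have "((\<lambda>z. f z ** g z) \<longlongrightarrow> A ** B) (at k) \<longleftrightarrow> ((\<lambda>z. g z ** f z) \<longlongrightarrow> A ** B) (at k)"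
    using assms(1) unfolding germs_commute_def by (rule tendsto_cong)
  ultimately show ?thesis using tendsto_unique trivial_limit_at by blast
qed

lemma analytic_matrix_tendsto:
  assumes "\<forall>i j. (\<lambda>w. (f :: ('n::finite) matrix_fun) w $ i $ j) analytic_on {z}"
  shows "(f \<longlongrightarrow> f z) (at z)"
  using assms analytic_at_imp_isCont by (intro vec_tendstoI) (auto simp: isCont_def)

section \<open>Permutation of the branches\<close>

locale branched_matrix = algebraic_branches "strip \<epsilon>" G P
  for \<epsilon> :: real and G :: "('n::finite) matrix_fun" and P +
  fixes \<gamma> :: "complex \<Rightarrow> real \<Rightarrow> complex" and T :: "complex set"
  assumes G_meromorphic: "meromorphic_matrix_on G (strip \<epsilon>)"
    and T_def: "T = branch_points (strip \<epsilon>) G"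
    and T_strip: "T \<inter> strip \<epsilon> = {}"
    and cuts: "cut_system \<epsilon> T \<gamma>"
begin

definition word_germs :: "complex \<Rightarrow> 'n matrix_fun set" where
  "word_germs k = {g. \<exists>w\<in>lists T. continues_word \<epsilon> T \<gamma> w k G g}"

lemma reachable_base: "k \<in> strip \<epsilon> \<Longrightarrow> reachable (strip \<epsilon>) G k G"
  unfolding reachable_def
  using continues_along_linepath[OF G_meromorphic convex_strip, of k k]
  by (intro exI[of _ "linepath k k"]) simp

lemma word_germ_reachable:
  assumes "k \<in> strip \<epsilon>" "g \<in> word_germs k"
  shows "reachable (strip \<epsilon>) G k g"
  using assms continues_word_reachable[OF _ reachable_base] unfolding word_germs_def by blast

text \<open>A bypass avoids the branch points on all sheets, so continuation exists from any word
  germ, and the result is reached by the word with one more letter.\<close>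

lemma word_germ_continues:
  assumes k: "k \<in> strip \<epsilon>" and g: "g \<in> word_germs k" and "\<tau> \<in> T" and p: "bypass \<epsilon> T \<gamma> \<tau> k p"
  obtains h where "h \<in> word_germs k" "continues_along p g h"
proof -
  have pp: "path p" "pathstart p = k" using p by (simp_all add: bypass_def)
  obtain h where h: "continues_along p g h"
    using continuation_exists[OF pp(1)] bypass_avoids_branch_points[OF cuts p]
      word_germ_reachable[OF k g] pp(2) unfolding T_def by metis
  obtain w where w: "w \<in> lists T" "continues_word \<epsilon> T \<gamma> w k G g"
    using g unfolding word_germs_def by blast
  have "continues_word \<epsilon> T \<gamma> [\<tau>] k g h" using p h same_germ_refl by (simp only: continues_word.simps) blast
  from continues_word_append[OF w(2) this] have "h \<in> word_germs k"
    unfolding word_germs_def using w(1) \<open>\<tau> \<in> T\<close> by (intro CollectI bexI[of _ "w @ [\<tau>]"]) auto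
  with h show ?thesis by (intro that)
qed

text \<open>Continuation along a bypass is injective on the finitely many germs, hence surjective.\<close>

lemma word_germ_predecessor:
  assumes k: "k \<in> strip \<epsilon>" and g: "g \<in> word_germs k" and \<tau>: "\<tau> \<in> T" "bypass \<epsilon> T \<gamma> \<tau> k p"
  obtains h where "h \<in> word_germs k" "continues_along p h g"
proof -
  have pk: "pathstart p = k" "pathfinish p = k" using \<tau>(2) by (simp_all add: bypass_def)
  \<comment> \<open>The forward orbit of g under continuation along the one fixed bypass p.\<close>
  have "\<exists>s. \<forall>n::nat. (s n \<in> word_germs k \<and> (n = 0 \<longrightarrow> s n = g)) \<and> continues_along p (s n) (s (Suc n))"
  proof (rule dependent_nat_choice)
    fix h and n :: nat assume "h \<in> word_germs k \<and> (n = 0 \<longrightarrow> h = g)"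
    then obtain h' where "h' \<in> word_germs k" "continues_along p h h'"
      using word_germ_continues[OF k _ \<tau>] by blast
    then show "\<exists>h'. (h' \<in> word_germs k \<and> (Suc n = 0 \<longrightarrow> h' = g)) \<and> continues_along p h h'" by blast
  qed (use g in blast)
  then obtain s where s: "\<And>n. s n \<in> word_germs k" "s 0 = g" "\<And>n. continues_along p (s n) (s (Suc n))"
    by blast
  obtain m n where mn: "m < n" "same_germ k (s m) (s n)"
    by (rule pigeonhole_germs[OF word_germ_reachable[OF k s(1)]])
  \<comment> \<open>Injectivity removes l steps from both members of the repetition; l = m brings
    the earlier one back to s 0 = g.\<close>
  have "same_germ k (s (m - l)) (s (n - l))" if "l \<le> m" for l
    using that
  proof (induction l)
    case (Suc l)
    then have "Suc (m - Suc l) = m - l" "Suc (n - Suc l) = n - l" using mn(1) by auto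
    then show ?case
      using continues_along_same_germ_iff[OF s(3)[of "m - Suc l"] s(3)[of "n - Suc l"]] Suc pk by simp
  qed (use mn in simp)
  from this[of m] have "same_germ k (s (n - m)) g" using s(2) same_germ_sym by simp
  \<comment> \<open>Since m < n, the index n - m is positive and the term before it is the required
    predecessor.\<close>
  moreover have "continues_along p (s (n - m - 1)) (s (n - m))"
    using s(3)[of "n - m - 1"] mn(1) by (simp add: Suc_diff_Suc)
  ultimately have "continues_along p (s (n - m - 1)) g"
    using continues_along_cong[OF _ same_germ_refl] pk(2) by blast
  with s(1) show ?thesis by (rule that)
qed

text \<open>The invariant, that all word germs commute with the current germ f, survives a bypass:
  any v has a predecessor v' along the same path, v' commutes with f, and continuing this relation
  makes v commute with the continuation of f.\<close>

lemma word_germs_commute: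
  assumes k: "k \<in> strip \<epsilon>" and base: "\<And>h. h \<in> word_germs k \<Longrightarrow> germs_commute k h G"
    and "g \<in> word_germs k" "h \<in> word_germs k"
  shows "germs_commute k g h"
proof -
  have *: "germs_commute k h f'" if "w \<in> lists T" "continues_word \<epsilon> T \<gamma> w k f f'"
    "\<And>h. h \<in> word_germs k \<Longrightarrow> germs_commute k h f" "h \<in> word_germs k" for w f f' h
    using that
  proof (induction w arbitrary: f h rule: list.induct)
    case Nil
    then show ?case using germs_commute_cong[OF same_germ_refl, of k f f' h] by simp
  next
    case (Cons \<tau> w)
    then obtain p u where pu: "bypass \<epsilon> T \<gamma> \<tau> k p" "continues_along p f u" "continues_word \<epsilon> T \<gamma> w k u f'"
      by auto
    have pk: "pathstart p = k" "pathfinish p = k" using pu(1) by (simp_all add: bypass_def)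
    have "germs_commute k v u" if v: "v \<in> word_germs k" for v
    proof -
      have "\<tau> \<in> T" using Cons.prems(1) by simp
      from word_germ_predecessor[OF k v this pu(1)]
      obtain v' where "v' \<in> word_germs k" "continues_along p v' v" by blast
      then show ?thesis
        using continues_along_commute_iff[OF _ pu(2), of v' v] Cons.prems(3)[of v'] pk by simp
    qed
    then show ?case using Cons.IH[of u h] Cons.prems(1,4) pu(3) by simp
  qed
  obtain w where "w \<in> lists T" "continues_word \<epsilon> T \<gamma> w k G h"
    using assms(4) unfolding word_germs_def by blast
  from *[OF this base assms(3)] show ?thesis .
qed

text \<open>Balancedness only equates sets of values, so commutation is checked value by value at the
  nearby points, through a one-sided continuation attaining the same value.\<close>

lemma word_germ_commutes_with_factor:
  assumes k: "k \<in> strip \<epsilon>" and g: "g \<in> word_germs k"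
    and Q: "meromorphic_matrix_on Q H" "strip \<epsilon> \<subseteq> H" and W: "W \<subseteq> lists T"
    and half: "\<And>w \<tau>. w \<in> W \<Longrightarrow> \<tau> \<in> set w \<Longrightarrow> (if 0 < Im \<tau> then upper_half \<epsilon> else lower_half \<epsilon>) = H"
    and GQ: "\<And>z. z \<in> strip \<epsilon> \<Longrightarrow> germs_commute z G Q"
    and balance: "\<And>w. w \<in> lists T \<Longrightarrow> \<exists>v\<in>W. \<forall>z\<in>strip \<epsilon>. word_values \<epsilon> \<gamma> G v z = word_values \<epsilon> \<gamma> G w z"
  shows "germs_commute k g Q"
proof -
  obtain w where w: "w \<in> lists T" "continues_word \<epsilon> T \<gamma> w k G g"
    using g unfolding word_germs_def by blast
  obtain v where v: "v \<in> W" "\<And>z. z \<in> strip \<epsilon> \<Longrightarrow> word_values \<epsilon> \<gamma> G v z = word_values \<epsilon> \<gamma> G w z"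
    using balance[OF w(1)] by blast
  have Gk: "meromorphic_matrix_on G {k}" and Qk: "meromorphic_matrix_on Q {k}"
    using G_meromorphic Q k by (auto intro: meromorphic_matrix_on_subset)
  have gk: "meromorphic_matrix_on g {k}" by (rule continues_word_meromorphic[OF w(2) Gk])
  show ?thesis
    unfolding germs_commute_def
    using continues_word_nearby[OF cuts T_strip k w Gk] meromorphic_matrix_on_eventually[OF gk]
      meromorphic_matrix_on_eventually[OF Qk] eventually_in_strip[OF k]
  proof eventually_elim
    case (elim z)
    have "g z \<in> word_values \<epsilon> \<gamma> G w z"
      unfolding word_values_def using elim(1) analytic_matrix_tendsto[OF elim(2)] T_def by blast
    then have "g z \<in> word_values \<epsilon> \<gamma> G v z" using v(2)[OF elim(4)] by simp
    \<comment> \<open>The germ h depends on z, and only its limit at z is known to agree with g z.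
      That suffices, because commutation with Q is now wanted at the single point z.\<close>
    then obtain h where h: "continues_word \<epsilon> T \<gamma> v z G h" "(h \<longlongrightarrow> g z) (at z)"
      unfolding word_values_def T_def by blast
    have "germs_commute z h Q"
      using half[OF v(1)] by (rule continues_word_commute[OF Q(1) _ h(1) GQ[OF elim(4)]])
    then show ?case
      using h(2) analytic_matrix_tendsto[OF elim(3)] by (rule germs_commute_limit)
  qed
qed

end

section \<open>The factors and the conclusion\<close>

lemma factor_on_meromorphic: "factor_on H Q \<Longrightarrow> meromorphic_matrix_on Q H"
  unfolding factor_on_def meromorphic_matrix_on_def nicely_meromorphic_on_def by blast

text \<open>The identities are given off the poles of the factors; poles are isolated, so they hold
  as identities of germs at every point of the strip.\<close>

lemma commutative_factorization_eventually:
  assumes fac: "commutative_factorization \<epsilon> G Qp Qm" and k: "k \<in> strip \<epsilon>"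
  shows "\<forall>\<^sub>F z in at k. Qp z ** Qm z = G z \<and> Qm z ** Qp z = G z"
proof -
  have Q: "meromorphic_matrix_on Qp (upper_half \<epsilon>)" "meromorphic_matrix_on Qm (lower_half \<epsilon>)"
    using fac unfolding commutative_factorization_def by (auto intro: factor_on_meromorphic)
  have "meromorphic_matrix_on Qp {k}" "meromorphic_matrix_on Qm {k}"
    using k strip_subset_half[of \<epsilon>]
    by (auto intro: meromorphic_matrix_on_subset[OF Q(1)] meromorphic_matrix_on_subset[OF Q(2)])
  from meromorphic_matrix_on_eventually[OF this(1)] meromorphic_matrix_on_eventually[OF this(2)]
    eventually_in_strip[OF k]
  show ?thesis
  proof eventually_elim
    case (elim z)
    then have "\<not> matrix_pole Qp z" "\<not> matrix_pole Qm z"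
      unfolding matrix_pole_def using analytic_at_imp_no_pole by blast+
    with fac elim(3) show ?case unfolding commutative_factorization_def by blast
  qed
qed

theorem theorem2:
  fixes G :: "complex \<Rightarrow> complex^'n^'n"
    and \<epsilon> :: real
    and \<gamma> :: "complex \<Rightarrow> real \<Rightarrow> complex"
  assumes "0 < \<epsilon>"
    and "algebraic_matrix_on (strip \<epsilon>) G"
    and "\<exists>k\<in>strip \<epsilon>. \<not> matrix_pole G k \<and> det (G k) \<noteq> 0"
    and "branch_points (strip \<epsilon>) G \<inter> strip \<epsilon> = {}"
    and "cut_system \<epsilon> (branch_points (strip \<epsilon>) G) \<gamma>"
    and "balanced \<epsilon> \<gamma> G"
    and "\<exists>Qp Qm. commutative_factorization \<epsilon> G Qp Qm"
  shows "branch_commutative \<epsilon> \<gamma> G"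
proof -
  let ?T = "branch_points (strip \<epsilon>) G"
  obtain P where "algebraic_branches (strip \<epsilon>) G P"
    by (rule algebraic_matrix_branches[OF assms(1,2)])
  then interpret algebraic_branches "strip \<epsilon>" G P .
  have Gmer: "meromorphic_matrix_on G (strip \<epsilon>)"
    using assms(2) unfolding algebraic_matrix_on_def meromorphic_matrix_on_def nicely_meromorphic_on_def by blast
  interpret branched_matrix \<epsilon> G P \<gamma> ?T
    by unfold_locales (use Gmer assms(4,5) in auto)
  obtain Qp Qm where fac: "commutative_factorization \<epsilon> G Qp Qm" using assms(7) by blast
  note ev = commutative_factorization_eventually[OF fac]
  have Q: "meromorphic_matrix_on Qp (upper_half \<epsilon>)" "meromorphic_matrix_on Qm (lower_half \<epsilon>)"
    using fac unfolding commutative_factorization_def by (auto intro: factor_on_meromorphic)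
  \<comment> \<open>Associativity: G Q+ = (Q+ Q-) Q+ = Q+ (Q- Q+) = Q+ G, and likewise for
    Q-.\<close>
  have GQ: "germs_commute k G Qp" "germs_commute k G Qm" if "k \<in> strip \<epsilon>" for k
    unfolding germs_commute_def using ev[OF that] by (eventually_elim, metis matrix_mul_assoc)+
  have bal: "\<exists>v\<in>a_words ?T. \<forall>z\<in>strip \<epsilon>. word_values \<epsilon> \<gamma> G v z = word_values \<epsilon> \<gamma> G w z"
      "\<exists>v\<in>b_words ?T. \<forall>z\<in>strip \<epsilon>. word_values \<epsilon> \<gamma> G v z = word_values \<epsilon> \<gamma> G w z"
    if w: "w \<in> lists ?T" for w
  proof -
    from bspec[OF assms(6)[unfolded balanced_def all_words_def Let_def] w]
    obtain wa wb where v: "wa \<in> a_words ?T" "wb \<in> b_words ?T"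
      "\<forall>z\<in>strip \<epsilon>. word_values \<epsilon> \<gamma> G wa z = word_values \<epsilon> \<gamma> G w z \<and>
         word_values \<epsilon> \<gamma> G wb z = word_values \<epsilon> \<gamma> G w z" by (elim bexE)
    show "\<exists>v\<in>a_words ?T. \<forall>z\<in>strip \<epsilon>. word_values \<epsilon> \<gamma> G v z = word_values \<epsilon> \<gamma> G w z"
      by (rule bexI[OF _ v(1)]) (simp add: v(3))
    show "\<exists>v\<in>b_words ?T. \<forall>z\<in>strip \<epsilon>. word_values \<epsilon> \<gamma> G v z = word_values \<epsilon> \<gamma> G w z"
      by (rule bexI[OF _ v(2)]) (simp add: v(3))
  qed
  \<comment> \<open>A germ commuting with both factors commutes with their product, which is the
    physical branch.\<close>
  have base: "germs_commute k g G" if k: "k \<in> strip \<epsilon>" and g: "g \<in> word_germs k" for k g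
  proof -
    have "germs_commute k g Qp"
      by (rule word_germ_commutes_with_factor[OF k g Q(1) strip_subset_half(1) _ _ GQ(1) bal(1)])
         (auto simp: a_words_def)
    moreover have "germs_commute k g Qm"
      by (rule word_germ_commutes_with_factor[OF k g Q(2) strip_subset_half(2) _ _ GQ(2) bal(2)])
         (auto simp: b_words_def in_lists_conv_set)
    ultimately show ?thesis
      unfolding germs_commute_def using ev[OF k] by eventually_elim (metis matrix_mul_assoc)
  qed
  show ?thesis
    unfolding branch_commutative_def Let_def all_words_def
  proof (intro ballI)
    fix k w1 w2 A B
    assume k: "k \<in> strip \<epsilon>" and w: "w1 \<in> lists ?T" "w2 \<in> lists ?T"
      and AB: "A \<in> word_values \<epsilon> \<gamma> G w1 k" "B \<in> word_values \<epsilon> \<gamma> G w2 k"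
    obtain g h where gh: "continues_word \<epsilon> ?T \<gamma> w1 k G g" "(g \<longlongrightarrow> A) (at k)"
        "continues_word \<epsilon> ?T \<gamma> w2 k G h" "(h \<longlongrightarrow> B) (at k)"
      using AB unfolding word_values_def by blast
    have "germs_commute k g h"
      using gh w by (intro word_germs_commute[OF k base[OF k]]) (auto simp: word_germs_def)
    from germs_commute_limit[OF this gh(2,4)] show "A ** B - B ** A = 0" by simp
  qed
qed

end
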